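(* Let $G,G',H,H'$ be graphs such that $G$ is a subgraph of $G'$ and $H$ is a subgraph of $H'$, and let $F$ be a field of characteristic zero or larger than $2^{|V(G')||V(H')|}$. Then $\ell(J_{G,H})\le \ell(J_{G',H'})$.
   Context: Graphs are finite and simple with no isolated vertices. Binomial edge ideal of a pair: for graphs $G$ on $[n]$ and $H$ on $[m]$, in $S=F[x_{i,j}\mid 1\le i\le n,1\le j\le m]$ let $J_{G,H}$ be the ideal generated by the binomials $x_{i,k}x_{j,l}-x_{i,l}x_{j,k}$ for all $\{i,j\}\in E(G)$, $i<j$, and $\{k,l\}\in E(H)$, $k<l$ (graphs with other vertex sets are relabelled; only the isomorphism type matters). Analytic spread: for an ideal $I\subset S$ with graded maximal ideal $\mathfrak m=(x_{i,j})$, $\ell(I)$ is the Krull dimension of the special fiber ring $\bigoplus_{k\ge0} I^k/\mathfrak m I^k$. *)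

theory Defs
  imports
    "HOL-Library.Poly_Mapping"
    "HOL-Library.Extended_Nat"
    "HOL-Computational_Algebra.Computational_Algebra"
    "HOL-Algebra.QuotRing"
    "HOL-Algebra.Ideal_Product"
    "Graph_Theory.Graph_Theory"
begin

section \<open>Krull dimension\<close>

text \<open>The supremum of the lengths \<open>n\<close> of chains \<open>P 0 \<subset> P 1 \<subset> \<dots> \<subset> P n\<close> of prime ideals.
  As the supremum is taken in \<^typ>\<open>enat\<close>, the zero ring gets dimension 0.\<close>

definition krull_dim :: "('a, 'm) ring_scheme \<Rightarrow> enat" where
  "krull_dim R = Sup {enat n | n. \<exists>P :: nat \<Rightarrow> 'a set.
     (\<forall>i\<le>n. primeideal (P i) R) \<and> (\<forall>i<n. P i \<subset> P (Suc i))}"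


section \<open>Special fiber ring and analytic spread\<close>

text \<open>\<^const>\<open>ideals_set\<close> is the multiplicative structure of ideals under the product of ideals with
  neutral element \<^term>\<open>carrier R\<close>; in particular \<open>I\<^sup>0\<close> is the whole ring.\<close>

abbreviation ideal_power :: "('a, 'm) ring_scheme \<Rightarrow> 'a set \<Rightarrow> nat \<Rightarrow> 'a set" where
  "ideal_power R I k \<equiv> I [^]\<^bsub>ideals_set R\<^esub> k"

text \<open>The graded ring \<open>\<Oplus>k. I\<^sup>k / M I\<^sup>k\<close>. Its elements are the finitely supported sequences \<open>x\<close> whose
  \<open>k\<close>-th entry is a coset of \<open>M I\<^sup>k\<close> with a representative in \<open>I\<^sup>k\<close>. The product of the cosets of
  \<open>a \<in> I\<^sup>i\<close> and \<open>b \<in> I\<^sup>j\<close> is the coset of \<open>a b\<close> modulo \<open>M I\<^sup>i\<^sup>+\<^sup>j\<close>.\<close>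

definition special_fiber_ring ::
    "('a, 'm) ring_scheme \<Rightarrow> 'a set \<Rightarrow> 'a set \<Rightarrow> (nat \<Rightarrow> 'a set) ring" where
  "special_fiber_ring R M I =
    (let J = (\<lambda>k. M \<cdot>\<^bsub>R\<^esub> ideal_power R I k) in
     \<lparr>carrier = {x. (\<forall>k. x k \<in> {J k +>\<^bsub>R\<^esub> a | a. a \<in> ideal_power R I k}) \<and> finite {k. x k \<noteq> J k}},
      mult = (\<lambda>x y k. \<Oplus>\<^bsub>R Quot J k\<^esub>i\<in>{..k}. ([mod J k:] x i \<Otimes>\<^bsub>R\<^esub> y (k - i))),
      one = (\<lambda>k. if k = 0 then J 0 +>\<^bsub>R\<^esub> \<one>\<^bsub>R\<^esub> else J k),
      zero = J,
      add = (\<lambda>x y k. x k <+>\<^bsub>R\<^esub> y k)\<rparr>)"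


section \<open>Polynomial rings\<close>

type_synonym ('v, 'f) mpoly = "('v \<Rightarrow>\<^sub>0 nat) \<Rightarrow>\<^sub>0 'f"

definition var :: "'v \<Rightarrow> ('v, 'f::field) mpoly" where
  "var v = Poly_Mapping.single (Poly_Mapping.single v 1) 1"

text \<open>The polynomial ring whose variables are indexed by the set \<open>V\<close>, as a subring of the type of all
  polynomials with variables indexed by \<^typ>\<open>'v\<close>.\<close>

definition poly_ring :: "'v set \<Rightarrow> ('v, 'f::field) mpoly ring" where
  "poly_ring V = \<lparr>carrier = {p. \<forall>t\<in>Poly_Mapping.keys p. Poly_Mapping.keys t \<subseteq> V},
     mult = (*), one = 1, zero = 0, add = (+)\<rparr>"

definition graded_maximal_ideal :: "'v set \<Rightarrow> ('v, 'f::field) mpoly set" where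
  "graded_maximal_ideal V = genideal (poly_ring V) (var ` V)"

definition analytic_spread :: "'v set \<Rightarrow> ('v, 'f::field) mpoly set \<Rightarrow> enat" where
  "analytic_spread V I =
     krull_dim (special_fiber_ring (poly_ring V) (graded_maximal_ideal V) I)"


section \<open>Binomial edge ideals of pairs of graphs\<close>

text \<open>A finite simple graph is a \<^const>\<open>pair_graph\<close>: the undirected edge \<open>{i, j}\<close> is
  represented by the two arcs \<open>(i, j)\<close> and \<open>(j, i)\<close>. Vertex sets are arbitrary finite subsets of
  a linear order instead of \<open>{1..n}\<close>.\<close>

definition no_isolated_vertices :: "'a pair_pre_digraph \<Rightarrow> bool" where
  "no_isolated_vertices G \<longleftrightarrow> (\<forall>u\<in>pverts G. \<exists>v. (u, v) \<in> parcs G)"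

definition binomial_edge_ideal ::
    "'a::linorder pair_pre_digraph \<Rightarrow> 'b::linorder pair_pre_digraph \<Rightarrow> ('a \<times> 'b, 'f::field) mpoly set"
  where
  "binomial_edge_ideal G H = genideal (poly_ring (pverts G \<times> pverts H))
     {var (i, k) * var (j, l) - var (i, l) * var (j, k) | i j k l.
        (i, j) \<in> parcs G \<and> i < j \<and> (k, l) \<in> parcs H \<and> k < l}"

end

theory Submission
  imports Defs "HOL-Library.Product_Lexorder"
begin

text \<open>The ideal \<open>J\<^sub>G\<^sub>,\<^sub>H\<close> is generated by forms of one degree, so its special fiber ring is the algebra
  \<open>F[X]\<close> generated by these forms inside the polynomial ring. Passing to larger graphs enlarges the
  algebra, and it remains to see that \<open>dim A \<le> dim A'\<close> for algebras \<open>F \<subseteq> A \<subseteq> A'\<close> in a domain with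
  \<open>A'\<close> finitely generated.

  Given a chain of primes \<open>P\<^sub>0 \<subset> \<dots> \<subset> P\<^sub>n\<close> of \<open>A\<close>, elements \<open>a\<^sub>i \<in> P\<^sub>i - P\<^sub>i\<^sub>-\<^sub>1\<close> are algebraically
  independent: \<open>a\<^sub>i\<close> is transcendental over \<open>F[a\<^sub>i\<^sub>+\<^sub>1, \<dots>, a\<^sub>n]\<close>. Extend them by generators of \<open>A'\<close> to a
  polynomial ring \<open>B \<subseteq> A'\<close> over which all generators are algebraic. In \<open>B\<close> there is a chain of
  primes of length at least \<open>n\<close> whose members avoid any prescribed nonzero element \<open>q\<close>. If \<open>q\<close> is a
  multiple of the leading coefficients of the algebraic relations, then the chain lifts to \<open>A'\<close> by
  going up.\<close>

section \<open>Subrings, prime ideals and adjunction of an element\<close>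

text \<open>A chain of primes of the smaller algebra need not lift: in F[x, xy] inside F[x, y], no
  prime lies above the one generated by x and xy - 1. Hence the given chain is used only to find
  independent elements, and a new chain is built on the polynomial ring, starting from the zero
  ideal. The remaining generators are algebraic over that ring but not integral; a prime still lifts
  if it misses the leading coefficient of a relation. As primes in a chain increase, it is enough
  that the top one misses it, and as all relations have coefficients in one fixed ring, finitely
  many leading coefficients can be gathered in a single product before any lifting starts.\<close>

definition is_subring :: "'r::comm_ring_1 set \<Rightarrow> bool" where
  "is_subring R \<longleftrightarrow> 0 \<in> R \<and> 1 \<in> R \<and> (\<forall>x\<in>R. \<forall>y\<in>R. x + y \<in> R \<and> x * y \<in> R) \<and> (\<forall>x\<in>R. - x \<in> R)"

text \<open>Rings and ideals are sets inside one ambient type, so that rings are compared by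
  inclusion and computed in with type class arithmetic; \<open>ring_on\<close> leads back to
  records. For a subring \<open>R\<close>, closure under negation comes from \<open>-1\<close> in
  \<open>R\<close>.\<close>

definition ideal_in :: "'r::comm_ring_1 set \<Rightarrow> 'r set \<Rightarrow> bool" where
  "ideal_in R I \<longleftrightarrow> I \<subseteq> R \<and> 0 \<in> I \<and> (\<forall>x\<in>I. \<forall>y\<in>I. x + y \<in> I) \<and> (\<forall>r\<in>R. \<forall>x\<in>I. r * x \<in> I)"

definition prime_in :: "'r::comm_ring_1 set \<Rightarrow> 'r set \<Rightarrow> bool" where
  "prime_in R P \<longleftrightarrow> ideal_in R P \<and> 1 \<notin> P \<and> (\<forall>x\<in>R. \<forall>y\<in>R. x * y \<in> P \<longrightarrow> x \<in> P \<or> y \<in> P)"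

definition prime_chain :: "'r::comm_ring_1 set \<Rightarrow> nat \<Rightarrow> (nat \<Rightarrow> 'r set) \<Rightarrow> bool" where
  "prime_chain R n P \<longleftrightarrow> (\<forall>i\<le>n. prime_in R (P i)) \<and> (\<forall>i<n. P i \<subset> P (Suc i))"

text \<open>\<open>S\<close> is an arbitrary set because it stands both for a subring
  \<open>R\<close>, giving R[x], and for an ideal of \<open>R\<close>, giving the extended ideal.
  For the same reason \<open>adjoin I x\<close> with an ideal \<open>I\<close> is the extension of
  \<open>I\<close> to R[x].\<close>

definition polys_over :: "'r::zero set \<Rightarrow> 'r poly set" where
  "polys_over S = {p. \<forall>i. coeff p i \<in> S}"

definition adjoin :: "'r::comm_ring_1 set \<Rightarrow> 'r \<Rightarrow> 'r set" where
  "adjoin R x = (\<lambda>p. poly p x) ` polys_over R"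

lemma is_subringD:
  assumes "is_subring R"
  shows "0 \<in> R" "1 \<in> R" "x \<in> R \<Longrightarrow> y \<in> R \<Longrightarrow> x + y \<in> R" "x \<in> R \<Longrightarrow> y \<in> R \<Longrightarrow> x * y \<in> R"
    "x \<in> R \<Longrightarrow> - x \<in> R" "x \<in> R \<Longrightarrow> y \<in> R \<Longrightarrow> x - y \<in> R"
  using assms unfolding is_subring_def by (auto simp: diff_conv_add_uminus simp del: add_uminus_conv_diff)

lemma is_subring_sum:
  assumes "is_subring R" "\<And>i. i \<in> A \<Longrightarrow> f i \<in> R"
  shows "sum f A \<in> R"
  using assms(2) by (induction A rule: infinite_finite_induct) (auto simp: is_subringD[OF assms(1)])

lemma is_subring_power: "is_subring R \<Longrightarrow> x \<in> R \<Longrightarrow> x ^ n \<in> R"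
  by (induction n) (auto simp: is_subringD)

lemma is_subring_hull: "is_subring (is_subring hull S)"
  by (rule hull_in) (auto simp: is_subring_def)

lemma ideal_inD:
  assumes "ideal_in R I"
  shows "x \<in> I \<Longrightarrow> x \<in> R" "0 \<in> I" "x \<in> I \<Longrightarrow> y \<in> I \<Longrightarrow> x + y \<in> I"
    "r \<in> R \<Longrightarrow> x \<in> I \<Longrightarrow> r * x \<in> I" "r \<in> R \<Longrightarrow> x \<in> I \<Longrightarrow> x * r \<in> I"
  using assms unfolding ideal_in_def by (auto simp: mult.commute)

lemma ideal_in_uminus:
  assumes "is_subring R" "ideal_in R I" "x \<in> I"
  shows "- x \<in> I"
  using ideal_inD(4)[OF assms(2), of "-1" x] is_subringD[OF assms(1)] assms(3) by simp

lemma ideal_in_diff: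
  assumes "is_subring R" "ideal_in R I" "x \<in> I" "y \<in> I"
  shows "x - y \<in> I"
  using ideal_inD(3)[OF assms(2,3) ideal_in_uminus[OF assms(1,2,4)]] by simp

lemma ideal_in_sum:
  assumes "ideal_in R I" "\<And>i. i \<in> A \<Longrightarrow> f i \<in> I"
  shows "sum f A \<in> I"
  using assms(2) by (induction A rule: infinite_finite_induct) (auto intro: ideal_inD[OF assms(1)])

lemma ideal_in_sum_set:
  assumes "is_subring R" "ideal_in R I" "ideal_in R J"
  shows "ideal_in R {x + y | x y. x \<in> I \<and> y \<in> J}" (is "ideal_in R ?N")
  unfolding ideal_in_def
proof (intro conjI ballI subsetI)
  show "0 \<in> ?N"
    using ideal_inD(2)[OF assms(2)] ideal_inD(2)[OF assms(3)] by (metis (mono_tags, lifting) add_0 mem_Collect_eq)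
next
  fix z assume "z \<in> ?N"
  then show "z \<in> R"
    using ideal_inD(1)[OF assms(2)] ideal_inD(1)[OF assms(3)] is_subringD(3)[OF assms(1)] by blast
next
  fix z w assume "z \<in> ?N" "w \<in> ?N"
  then obtain x y x' y' where *: "z = x + y" "w = x' + y'" "x \<in> I" "x' \<in> I" "y \<in> J" "y' \<in> J"
    by blast
  have "z + w = (x + x') + (y + y')" using * by (simp add: algebra_simps)
  then show "z + w \<in> ?N"
    using ideal_inD(3)[OF assms(2), of x x'] ideal_inD(3)[OF assms(3), of y y'] * by blast
next
  fix r z assume "r \<in> R" "z \<in> ?N"
  then obtain x y where *: "z = x + y" "x \<in> I" "y \<in> J" by blast
  then have "r * z = r * x + r * y" by (simp add: algebra_simps)
  then show "r * z \<in> ?N"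
    using ideal_inD(4)[OF assms(2), of r x] ideal_inD(4)[OF assms(3), of r y] * \<open>r \<in> R\<close> by blast
qed

lemma ideal_in_principal:
  assumes "is_subring R" "a \<in> R"
  shows "ideal_in R ((*) a ` R)"
  unfolding ideal_in_def
proof (intro conjI ballI subsetI)
  show "0 \<in> (*) a ` R" using is_subringD(1)[OF assms(1)] by (metis image_eqI mult_zero_right)
next
  fix z assume "z \<in> (*) a ` R"
  then show "z \<in> R" using assms is_subringD(4) by blast
next
  fix z w assume "z \<in> (*) a ` R" "w \<in> (*) a ` R"
  then show "z + w \<in> (*) a ` R"
    using is_subringD(3)[OF assms(1)] by (auto simp flip: distrib_left)
next
  fix r z assume "r \<in> R" "z \<in> (*) a ` R"
  then show "r * z \<in> (*) a ` R"
    using is_subringD(4)[OF assms(1)] by (auto simp: mult.left_commute)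
qed

lemma prime_inD:
  assumes "prime_in R P"
  shows "ideal_in R P" "1 \<notin> P" "x \<in> R \<Longrightarrow> y \<in> R \<Longrightarrow> x * y \<in> P \<Longrightarrow> x \<in> P \<or> y \<in> P"
  using assms unfolding prime_in_def by auto

text \<open>An ideal maximal among those that contain \<open>N\<close> and miss the multiplicative
  set \<open>S\<close> is prime: if \<open>x\<close> and \<open>y\<close> lie outside it, enlarging
  it by either one produces an element of \<open>S\<close>, and \<open>x * y\<close> inside would
  put the product of these two elements into both \<open>P\<close> and \<open>S\<close>.\<close>

lemma exists_prime_avoiding:
  assumes R: "is_subring R" and N: "ideal_in R N"
    and S: "S \<subseteq> R" "1 \<in> S" "\<And>x y. x \<in> S \<Longrightarrow> y \<in> S \<Longrightarrow> x * y \<in> S" and "N \<inter> S = {}"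
  obtains P where "prime_in R P" "N \<subseteq> P" "P \<inter> S = {}"
proof -
  define \<A> where "\<A> = {I. ideal_in R I \<and> N \<subseteq> I \<and> I \<inter> S = {}}"
  have "\<exists>M\<in>\<A>. \<forall>X\<in>\<A>. M \<subseteq> X \<longrightarrow> X = M"
  proof (rule subset_Zorn_nonempty)
    show "\<A> \<noteq> {}" using N assms(6) unfolding \<A>_def by blast
  next
    fix \<C> assume C: "\<C> \<noteq> {}" "subset.chain \<A> \<C>"
    then have sub: "\<And>I. I \<in> \<C> \<Longrightarrow> ideal_in R I \<and> N \<subseteq> I \<and> I \<inter> S = {}"
      unfolding subset.chain_def \<A>_def by auto
    have "ideal_in R (\<Union>\<C>)"
      unfolding ideal_in_def
    proof (intro conjI ballI)
      fix x y assume "x \<in> \<Union>\<C>" "y \<in> \<Union>\<C>"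
      then obtain I J where *: "I \<in> \<C>" "J \<in> \<C>" "x \<in> I" "y \<in> J" by blast
      moreover from C(2) *(1,2) have "I \<subseteq> J \<or> J \<subseteq> I"
        unfolding subset.chain_def by blast
      ultimately obtain K where "K \<in> \<C>" "x \<in> K" "y \<in> K" by blast
      then show "x + y \<in> \<Union>\<C>" using ideal_inD(3)[of R K x y] sub[of K] by auto
    next
      fix r x assume "r \<in> R" "x \<in> \<Union>\<C>"
      then obtain I where "I \<in> \<C>" "x \<in> I" by blast
      then show "r * x \<in> \<Union>\<C>" using ideal_inD(4)[of R I r x] sub[of I] \<open>r \<in> R\<close> by auto
    next
      show "\<Union>\<C> \<subseteq> R" by (rule Union_least) (use sub in \<open>simp add: ideal_in_def\<close>)
      show "0 \<in> \<Union>\<C>" using sub C(1) by (auto simp: ideal_in_def)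
    qed
    moreover have "N \<subseteq> \<Union>\<C>" using sub C(1) by (metis Union_upper ex_in_conv subset_trans)
    moreover have "\<Union>\<C> \<inter> S = {}" using sub by (simp add: Int_Union2)
    ultimately show "\<Union>\<C> \<in> \<A>" by (simp add: \<A>_def)
  qed
  then obtain P where P: "ideal_in R P" "N \<subseteq> P" "P \<inter> S = {}"
    and max: "\<And>X. ideal_in R X \<Longrightarrow> N \<subseteq> X \<Longrightarrow> X \<inter> S = {} \<Longrightarrow> P \<subseteq> X \<Longrightarrow> X = P"
    unfolding \<A>_def by auto
  have meet: "\<exists>p\<in>P. \<exists>r\<in>R. p + x * r \<in> S" if "x \<in> R" "x \<notin> P" for x
  proof -
    define X where "X = {p + z | p z. p \<in> P \<and> z \<in> (*) x ` R}"
    have "ideal_in R X"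
      unfolding X_def by (rule ideal_in_sum_set[OF R P(1) ideal_in_principal[OF R that(1)]])
    moreover have "P \<subseteq> X"
    proof
      fix p assume "p \<in> P"
      moreover have "p = p + x * 0" by simp
      ultimately show "p \<in> X" unfolding X_def using is_subringD(1)[OF R] by blast
    qed
    moreover have "x \<in> X"
    proof -
      have "x = 0 + x * 1" by simp
      then show ?thesis unfolding X_def using is_subringD(2)[OF R] ideal_inD(2)[OF P(1)] by blast
    qed
    ultimately have "X \<inter> S \<noteq> {}" using max[of X] P(2) that(2) by blast
    then show ?thesis unfolding X_def by blast
  qed
  have "prime_in R P"
    unfolding prime_in_def
  proof (intro conjI ballI impI)
    fix x y assume xy: "x \<in> R" "y \<in> R" "x * y \<in> P"
    show "x \<in> P \<or> y \<in> P"
    proof (rule ccontr)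
      assume "\<not> (x \<in> P \<or> y \<in> P)"
      then obtain p r p' r' where *: "p \<in> P" "r \<in> R" "p + x * r \<in> S" "p' \<in> P" "r' \<in> R" "p' + y * r' \<in> S"
        using meet xy(1,2) by meson
      have "(p + x * r) * (p' + y * r') = p * (p' + y * r') + ((x * r) * p' + (r * r') * (x * y))"
        by (simp add: algebra_simps)
      also have "\<dots> \<in> P"
      proof (intro ideal_inD(3)[OF P(1)])
        show "p * (p' + y * r') \<in> P" using * S(1) by (intro ideal_inD(5)[OF P(1)]) auto
        show "x * r * p' \<in> P" using * xy is_subringD(4)[OF R] by (auto intro: ideal_inD(4)[OF P(1)])
        show "r * r' * (x * y) \<in> P" using * xy is_subringD(4)[OF R] by (auto intro: ideal_inD(4)[OF P(1)])
      qed
      finally show False using S(3)[OF *(3,6)] P(3) by blast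
    qed
  qed (use P S in auto)
  from that[OF this P(2,3)] show ?thesis .
qed

section \<open>Polynomials with coefficients in a subring or an ideal, and their values\<close>

lemma polys_over_pCons: "pCons a p \<in> polys_over S \<longleftrightarrow> a \<in> S \<and> p \<in> polys_over S"
  unfolding polys_over_def by (auto simp: coeff_pCons split: nat.splits)

lemma polys_over_mult:
  assumes "is_subring R" "ideal_in R I" "p \<in> polys_over R" "q \<in> polys_over I"
  shows "p * q \<in> polys_over I"
  using assms unfolding polys_over_def
  by (auto simp: coeff_mult intro!: ideal_in_sum[OF assms(2)] ideal_inD(4)[OF assms(2)])

lemma ideal_in_self: "is_subring R \<Longrightarrow> ideal_in R R"
  unfolding ideal_in_def by (auto simp: is_subringD)

lemma ideal_in_polys_over:
  assumes "is_subring R" "ideal_in R I"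
  shows "ideal_in (polys_over R) (polys_over I)"
  unfolding ideal_in_def
proof (intro conjI ballI)
  fix p q assume "p \<in> polys_over R" "q \<in> polys_over I"
  then show "p * q \<in> polys_over I" by (rule polys_over_mult[OF assms])
qed (use ideal_inD[OF assms(2)] in \<open>auto simp: polys_over_def\<close>)

lemma is_subring_polys_over:
  assumes "is_subring R"
  shows "is_subring (polys_over R)"
proof -
  note * = ideal_in_polys_over[OF assms ideal_in_self[OF assms]]
  show ?thesis
    unfolding is_subring_def using ideal_inD[OF *] is_subringD[OF assms]
    by (auto simp: polys_over_def coeff_1)
qed

lemma adjoinI: "p \<in> polys_over S \<Longrightarrow> poly p x \<in> adjoin S x"
  unfolding adjoin_def by blast

lemma adjoinE:
  assumes "z \<in> adjoin S x"
  obtains p where "p \<in> polys_over S" "z = poly p x"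
  using assms unfolding adjoin_def by blast

lemma ideal_in_adjoin:
  assumes "is_subring R" "ideal_in R I"
  shows "ideal_in (adjoin R x) (adjoin I x)"
proof -
  note * = ideal_inD[OF ideal_in_polys_over[OF assms]]
  show ?thesis
    unfolding ideal_in_def
  proof (intro conjI ballI subsetI)
    show "0 \<in> adjoin I x" using adjoinI[OF *(2), of x] by simp
  next
    fix a b assume "a \<in> adjoin I x" "b \<in> adjoin I x"
    then show "a + b \<in> adjoin I x" by (elim adjoinE) (simp add: adjoinI *(3) flip: poly_add)
  next
    fix a b assume "a \<in> adjoin R x" "b \<in> adjoin I x"
    then show "a * b \<in> adjoin I x" by (elim adjoinE) (simp add: adjoinI *(4) flip: poly_mult)
  next
    fix a assume "a \<in> adjoin I x"
    then show "a \<in> adjoin R x" by (elim adjoinE) (simp add: adjoinI *(1))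
  qed
qed

lemma is_subring_adjoin:
  assumes "is_subring R"
  shows "is_subring (adjoin R x)"
proof -
  note * = is_subringD[OF is_subring_polys_over[OF assms]]
  note I = ideal_inD[OF ideal_in_adjoin[OF assms ideal_in_self[OF assms]]]
  have "1 \<in> adjoin R x" using adjoinI[OF *(2), of x] by simp
  moreover have "- a \<in> adjoin R x" if "a \<in> adjoin R x" for a
    using that by (elim adjoinE) (simp add: adjoinI *(5) flip: poly_minus)
  ultimately show ?thesis
    unfolding is_subring_def by (intro conjI ballI I(2-4))
qed

lemma subset_adjoin: "0 \<in> I \<Longrightarrow> I \<subseteq> adjoin I x"
  unfolding adjoin_def by (force simp: polys_over_pCons polys_over_def coeff_pCons split: nat.splits
      intro!: image_eqI[where x = "[:_:]"])

lemma adjoin_self: "is_subring R \<Longrightarrow> x \<in> adjoin R x"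
  unfolding adjoin_def by (rule image_eqI[where x = "[:0, 1:]"])
    (auto simp: polys_over_def coeff_pCons is_subringD split: nat.splits)

lemma adjoin_subset:
  assumes "is_subring S" "R \<subseteq> S" "x \<in> S"
  shows "adjoin R x \<subseteq> S"
proof
  fix z assume "z \<in> adjoin R x"
  then obtain p where "z = poly p x" "\<And>i. coeff p i \<in> R" unfolding adjoin_def polys_over_def by blast
  then show "z \<in> S"
    unfolding \<open>z = _\<close> poly_altdef using assms(2,3)
    by (intro is_subring_sum[OF assms(1)] is_subringD(4)[OF assms(1)] is_subring_power[OF assms(1)]) auto
qed

text \<open>Going up treats one element at a time, while the algebras of interest are generated by
  sets; this connects the two.\<close>

lemma adjoin_eq_hull:
  assumes "is_subring R"
  shows "adjoin R x = is_subring hull (insert x R)"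
proof (rule hull_unique[symmetric])
  show "insert x R \<subseteq> adjoin R x"
    using adjoin_self[OF assms] subset_adjoin is_subringD(1)[OF assms] by blast
  show "is_subring (adjoin R x)" by (rule is_subring_adjoin[OF assms])
  show "adjoin R x \<subseteq> t" if "insert x R \<subseteq> t" "is_subring t" for t
    using that by (intro adjoin_subset) auto
qed

section \<open>Going up\<close>

text \<open>The relation \<open>p\<close> says that \<open>f\<close> is integral, the relation \<open>g\<close> that \<open>1\<close> lies in the extension
  of \<open>P\<close>, in both cases after localization at \<open>P\<close> and modulo \<open>Q\<close>. As in Chevalley's extension
  theorem, the leading term of the one of larger degree is cancelled with the other: \<open>g\<close> loses its
  top coefficient, or \<open>p\<close> its constant coefficient and then a factor \<open>f\<close>.\<close>

lemma going_up_degree: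
  fixes f :: "'r::idom"
  assumes R: "is_subring R" and P: "prime_in R P" and Q: "prime_in (adjoin R f) Q" "Q \<inter> R \<subseteq> P"
  shows "p \<in> polys_over R \<Longrightarrow> degree p \<le> d \<Longrightarrow> coeff p d \<notin> P \<Longrightarrow> poly p f \<in> Q \<Longrightarrow>
     g \<in> polys_over R \<Longrightarrow> degree g \<le> e \<Longrightarrow> coeff g 0 \<notin> P \<Longrightarrow> (\<And>i. i > 0 \<Longrightarrow> coeff g i \<in> P) \<Longrightarrow>
     poly g f \<in> Q \<Longrightarrow> False"
proof (induction "d + e" arbitrary: d e p g rule: less_induct)
  case less
  note PI = prime_inD(1)[OF P] and QI = prime_inD(1)[OF Q(1)]
  note R' = is_subring_adjoin[OF R, of f]
  note poly_R = is_subringD[OF is_subring_polys_over[OF R]]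
  have sub: "R \<subseteq> adjoin R f" using subset_adjoin is_subringD(1)[OF R] by blast
  have cR: "coeff p i \<in> R" "coeff g i \<in> R" for i using less.prems(1,5) unfolding polys_over_def by auto
  have smult: "smult a q \<in> polys_over R" if "a \<in> R" "q \<in> polys_over R" for a q
    using that is_subringD(4)[OF R] unfolding polys_over_def by auto
  have scale: "a * z \<in> Q" if "a \<in> R" "z \<in> Q" for a z
    using that sub ideal_inD(4)[OF QI] by blast
  \<comment> \<open>A constant relation is impossible: its coefficient would lie in \<open>Q\<close>
    and in \<open>R\<close> but not in \<open>P\<close>.\<close>
  consider "d = 0" | "e = 0" | "d > 0" "e \<ge> d" | "d > e" "e > 0" by linarith
  then show False
  proof cases
    case 1
    then obtain a where "p = [:a:]" using less.prems(2) by (metis degree_eq_zeroE le_zero_eq)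
    then show False using less.prems Q(2) cR(1)[of 0] 1 by auto
  next
    case 2
    then obtain a where "g = [:a:]" using less.prems(6) by (metis degree_eq_zeroE le_zero_eq)
    then show False using less.prems Q(2) cR(2)[of 0] by auto
  next
    case 3
    define c where "c = coeff p d"
    define b where "b = coeff g e"
    \<comment> \<open>The terms of degree \<open>e\<close> cancel. As \<open>b\<close> is in
      \<open>P\<close>, modulo \<open>P\<close> this is just \<open>g\<close> scaled by
      \<open>c\<close>, so the shape of \<open>g\<close> survives with bound
      \<open>e - 1\<close>.\<close>
    define h where "h = smult c g - monom b (e - d) * p"
    have b: "b \<in> P" using less.prems(8)[of e] 3 by (simp add: b_def)
    have c: "c \<in> R" "c \<notin> P" using cR less.prems(3) by (auto simp: c_def)
    have bp: "coeff (monom b (e - d) * p) i \<in> P" for i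
      using ideal_inD(2)[OF PI] ideal_inD(5)[OF PI cR(1) b] by (auto simp: coeff_monom_mult)
    have coeff_h: "coeff h i = c * coeff g i - coeff (monom b (e - d) * p) i" for i by (simp add: h_def)
    have "monom b (e - d) * p \<in> polys_over R"
      using bp ideal_inD(1)[OF PI] unfolding polys_over_def by blast
    then have "h \<in> polys_over R" unfolding h_def by (intro poly_R(6) smult c less.prems(5))
    moreover have "degree h \<le> e - 1"
    proof (rule degree_le, intro allI impI)
      fix i assume "e - 1 < i"
      then consider "i = e" | "i > e" by linarith
      then show "coeff h i = 0"
      proof cases
        case 1
        then show ?thesis using 3 by (simp add: coeff_h coeff_monom_mult b_def c_def)
      next
        case 2
        then have "coeff g i = 0" "coeff p (i - (e - d)) = 0"
          using less.prems(2,6) 3 by (auto intro!: coeff_eq_0)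
        then show ?thesis by (simp add: coeff_h coeff_monom_mult)
      qed
    qed
    moreover have "coeff h 0 \<notin> P"
    proof
      assume "coeff h 0 \<in> P"
      then have "c * coeff g 0 \<in> P" using ideal_inD(3)[OF PI _ bp, of "coeff h 0" 0] by (simp add: coeff_h)
      then show False using prime_inD(3)[OF P c(1) cR(2)] c(2) less.prems(7) by blast
    qed
    moreover have "coeff h i \<in> P" if "i > 0" for i
      unfolding coeff_h by (intro ideal_in_diff[OF R PI] ideal_inD(4)[OF PI] c bp less.prems(8) that)
    moreover have "poly h f \<in> Q"
    proof -
      have "poly (monom b (e - d)) f \<in> adjoin R f"
        using ideal_inD(1)[OF PI b] is_subringD(1)[OF R] by (intro adjoinI) (simp add: polys_over_def)
      then show ?thesis
        unfolding h_def using ideal_in_diff[OF R' QI] scale[OF c(1) less.prems(9)]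
          ideal_inD(4)[OF QI _ less.prems(4)] by simp
    qed
    ultimately show False
      using less.hyps[of d "e - 1" p h] 3 less.prems(1-4) by simp
  next
    case 4
    \<comment> \<open>The constant terms cancel. As \<open>g\<close> has no term of degree
      \<open>d\<close>, the top coefficient becomes \<open>coeff g 0 * coeff p d\<close>, still
      outside \<open>P\<close>.\<close>
    define h' where "h' = smult (coeff g 0) p - smult (coeff p 0) g"
    have "coeff h' 0 = 0" by (simp add: h'_def)
    then obtain h where h: "h' = pCons 0 h" by (metis coeff_pCons_0 pCons_cases)
    have h'R: "h' \<in> polys_over R" unfolding h'_def by (intro poly_R(6) smult cR less.prems(1,5))
    then have hR: "h \<in> polys_over R" by (simp add: h polys_over_pCons)
    have "degree h' \<le> d"
      unfolding h'_def using less.prems(2,6) 4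
      by (intro degree_diff_le) (auto intro: order.trans[OF degree_smult_le])
    then have "degree h \<le> d - 1" by (cases "h = 0") (auto simp: h)
    moreover have "coeff h (d - 1) = coeff h' d" using 4 by (simp add: h coeff_pCons split: nat.splits)
    then have "coeff h (d - 1) = coeff g 0 * coeff p d"
      using 4 less.prems(6) by (simp add: h'_def coeff_eq_0)
    then have "coeff h (d - 1) \<notin> P"
      using prime_inD(3)[OF P cR(2) cR(1)] less.prems(3,7) by auto
    moreover have "poly h f \<in> Q"
    proof -
      have "f * poly h f = poly h' f" by (simp add: h)
      also have "\<dots> \<in> Q"
        unfolding h'_def using ideal_in_diff[OF R' QI] scale cR less.prems(4,9) by simp
      finally have "f \<in> Q \<or> poly h f \<in> Q"
        using prime_inD(3)[OF Q(1) adjoin_self[OF R] adjoinI[OF hR]] by blast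
      \<comment> \<open>This permits dividing by \<open>f\<close>: with \<open>f\<close> in
        \<open>Q\<close>, the relation \<open>g\<close> would force its constant coefficient into
        \<open>Q\<close>.\<close>
      moreover have False if "f \<in> Q"
      proof -
        obtain a g' where g: "g = pCons a g'" by (rule pCons_cases)
        have "g' \<in> polys_over R" using less.prems(5) by (simp add: g polys_over_pCons)
        then have "f * poly g' f \<in> Q" by (intro ideal_inD(5)[OF QI _ that] adjoinI)
        from ideal_in_diff[OF R' QI less.prems(9) this] have "a \<in> Q" by (simp add: g)
        then show False using Q(2) cR(2)[of 0] less.prems(7) by (auto simp: g)
      qed
      ultimately show ?thesis by blast
    qed
    ultimately show False
      using less.hyps[of "d - 1" e h g] 4 less.prems(5-9) hR by simp
  qed
qed

text \<open>Any prime that contains \<open>Q\<close> and \<open>P\<close> and misses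
  \<open>R - P\<close> will do. It exists once the sum of \<open>Q\<close> and the extension of
  \<open>P\<close> misses \<open>R - P\<close>, which is what \<open>going_up_degree\<close>
  provides.\<close>

lemma going_up_adjoin:
  fixes f :: "'r::idom"
  assumes R: "is_subring R" and P: "prime_in R P" and Q: "prime_in (adjoin R f) Q" "Q \<inter> R \<subseteq> P"
    and p: "p \<in> polys_over R" "lead_coeff p \<notin> P" "poly p f = 0"
  obtains Q' where "prime_in (adjoin R f) Q'" "Q \<subseteq> Q'" "Q' \<inter> R = P"
proof -
  note PI = prime_inD(1)[OF P] and QI = prime_inD(1)[OF Q(1)]
  note R' = is_subring_adjoin[OF R, of f] and PI' = ideal_in_adjoin[OF R PI, of f]
  define N where "N = {z + w | z w. z \<in> Q \<and> w \<in> adjoin P f}"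
  have N: "ideal_in (adjoin R f) N" unfolding N_def by (rule ideal_in_sum_set[OF R' QI PI'])
  have "N \<inter> (R - P) = {}"
  proof (rule ccontr)
    assume "N \<inter> (R - P) \<noteq> {}"
    then obtain b z u where b: "b \<in> R" "b \<notin> P" "z \<in> Q" "u \<in> polys_over P" "b = z + poly u f"
      unfolding N_def by (auto elim!: adjoinE)
    have u: "coeff u i \<in> P" for i using b(4) by (auto simp: polys_over_def)
    have coeff: "coeff ([:b:] - u) i = (if i = 0 then b - coeff u 0 else - coeff u i)" for i
      by (simp add: coeff_pCons split: nat.splits)
    \<comment> \<open>The element \<open>b = z + poly u f\<close> yields the second relation
      \<open>[:b:] - u\<close>: its value at \<open>f\<close> is \<open>z\<close>, its constant
      coefficient is outside \<open>P\<close>, and all others are inside.\<close>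
    show False
    proof (rule going_up_degree[OF R P Q p(1) order.refl p(2) _ _ order.refl, of "[:b:] - u"])
      show "poly p f \<in> Q" using p(3) ideal_inD(2)[OF QI] by simp
      show "[:b:] - u \<in> polys_over R"
        using b(1) u ideal_inD(1)[OF PI] is_subringD(5,6)[OF R] by (simp add: polys_over_def coeff del: coeff_diff)
      show "coeff ([:b:] - u) 0 \<notin> P"
        using ideal_inD(3)[OF PI _ u, of "b - coeff u 0" 0] b(2) by (auto simp: coeff)
      show "coeff ([:b:] - u) i \<in> P" if "i > 0" for i
        using that ideal_in_uminus[OF R PI u] by (simp add: coeff del: coeff_diff)
      show "poly ([:b:] - u) f \<in> Q" using b(3,5) by simp
    qed
  qed
  moreover have "R - P \<subseteq> adjoin R f" using subset_adjoin is_subringD(1)[OF R] by blast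
  moreover have "1 \<in> R - P" using prime_inD(2)[OF P] is_subringD(2)[OF R] by blast
  moreover have "x * y \<in> R - P" if "x \<in> R - P" "y \<in> R - P" for x y
    using that prime_inD(3)[OF P] is_subringD(4)[OF R] by blast
  ultimately obtain Q' where Q': "prime_in (adjoin R f) Q'" "N \<subseteq> Q'" "Q' \<inter> (R - P) = {}"
    using exists_prime_avoiding[OF R' N, of "R - P"] by blast
  have "Q \<subseteq> N"
    unfolding N_def using ideal_inD(2)[OF PI'] by (smt (verit) add.right_neutral mem_Collect_eq subsetI)
  moreover have "adjoin P f \<subseteq> N"
    unfolding N_def using ideal_inD(2)[OF QI] by (smt (verit) add_0 mem_Collect_eq subsetI)
  then have "P \<subseteq> N" using subset_adjoin ideal_inD(2)[OF PI] by blast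
  ultimately show ?thesis using that[OF Q'(1)] Q'(2,3) ideal_inD(1)[OF PI] by blast
qed

lemma prime_in_zero: "is_subring (R :: 'r::idom set) \<Longrightarrow> prime_in R {0}"
  by (auto simp: prime_in_def ideal_in_def is_subringD)

lemma prime_chain_mono: "prime_chain R n P \<Longrightarrow> m \<le> n \<Longrightarrow> prime_chain R m P"
  unfolding prime_chain_def by auto

lemma prime_chain_subset:
  assumes "prime_chain R n P" "i \<le> j" "j \<le> n"
  shows "P i \<subseteq> P j"
  using assms(2,3,1)
proof (induction rule: dec_induct)
  case (step m)
  then show ?case using psubset_imp_subset[of "P m" "P (Suc m)"] by (auto simp: prime_chain_def)
qed simp

lemma going_up_chain:
  fixes f :: "'r::idom"
  assumes R: "is_subring R" and p: "p \<in> polys_over R" "poly p f = 0"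
  shows "prime_chain R n P \<Longrightarrow> lead_coeff p \<notin> P n \<Longrightarrow>
    \<exists>Q. prime_chain (adjoin R f) n Q \<and> (\<forall>i\<le>n. Q i \<inter> R = P i)"
proof (induction n)
  case 0
  then have P: "prime_in R (P 0)" by (simp add: prime_chain_def)
  \<comment> \<open>There is no earlier prime to build on, so the zero ideal of the domain R[f]
    takes that place.\<close>
  have "{0} \<inter> R \<subseteq> P 0" using ideal_inD(2)[OF prime_inD(1)[OF P]] by auto
  from going_up_adjoin[OF R P prime_in_zero[OF is_subring_adjoin[OF R]] this p(1) 0(2) p(2)]
  obtain Q where "prime_in (adjoin R f) Q" "Q \<inter> R = P 0" by blast
  then show ?case by (intro exI[of _ "\<lambda>_. Q"]) (simp add: prime_chain_def)
next
  case (Suc n)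
  have P: "prime_in R (P (Suc n))" "P n \<subset> P (Suc n)" using Suc.prems(1) by (auto simp: prime_chain_def)
  then obtain Q where Q: "prime_chain (adjoin R f) n Q" "\<And>i. i \<le> n \<Longrightarrow> Q i \<inter> R = P i"
    using Suc.IH[OF prime_chain_mono[OF Suc.prems(1)]] Suc.prems(2) by auto
  then have "prime_in (adjoin R f) (Q n)" "Q n \<inter> R \<subseteq> P (Suc n)"
    using P(2) by (auto simp: prime_chain_def)
  from going_up_adjoin[OF R P(1) this p(1) Suc.prems(2) p(2)]
  obtain Q' where Q': "prime_in (adjoin R f) Q'" "Q n \<subseteq> Q'" "Q' \<inter> R = P (Suc n)" by blast
  define Q2 where "Q2 = Q(Suc n := Q')"
  have int: "Q2 i \<inter> R = P i" if "i \<le> Suc n" for i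
    using that Q' Q(2) by (auto simp: Q2_def le_Suc_eq)
  have "prime_chain (adjoin R f) (Suc n) Q2"
    unfolding prime_chain_def
  proof (intro conjI allI impI)
    fix i assume "i \<le> Suc n"
    then show "prime_in (adjoin R f) (Q2 i)"
      using Q(1) Q'(1) by (auto simp: Q2_def prime_chain_def)
  next
    fix i assume i: "i < Suc n"
    then have "Q2 i \<subseteq> Q2 (Suc i)" using Q(1) Q'(2) by (auto simp: Q2_def prime_chain_def less_Suc_eq)
    moreover have "P i \<subset> P (Suc i)" using Suc.prems(1) i by (auto simp: prime_chain_def)
    ultimately show "Q2 i \<subset> Q2 (Suc i)" using int[of i] int[of "Suc i"] i by auto
  qed
  with int show ?case by blast
qed

section \<open>Chains of primes avoiding an element\<close>

text \<open>Allowing only \<open>q \<in> B\<close>, with \<open>B\<close> kept fixed, makes the property inherited by an extension of \<open>R\<close>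
  by an element algebraic over \<open>B\<close>: it suffices to avoid the product of \<open>q\<close> and a leading coefficient.\<close>

definition avoiding_chains :: "'r::comm_ring_1 set \<Rightarrow> 'r set \<Rightarrow> nat \<Rightarrow> bool" where
  "avoiding_chains B R n \<longleftrightarrow> (\<forall>q\<in>B - {0}. \<exists>P. prime_chain R n P \<and> q \<notin> P n)"

lemma avoiding_chains_mono:
  assumes "avoiding_chains B R n" "m \<le> n"
  shows "avoiding_chains B R m"
  unfolding avoiding_chains_def
proof
  fix q assume "q \<in> B - {0}"
  with assms(1) obtain P where P: "prime_chain R n P" "q \<notin> P n" unfolding avoiding_chains_def by blast
  then have "q \<notin> P m" using prime_chain_subset[OF P(1) assms(2) order.refl] by auto
  then show "\<exists>P. prime_chain R m P \<and> q \<notin> P m" using prime_chain_mono[OF P(1) assms(2)] by auto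
qed

lemma avoiding_chains_algebraic:
  fixes f :: "'r::idom"
  assumes R: "is_subring R" and B: "is_subring B" "B \<subseteq> R" "avoiding_chains B R n"
    and p: "p \<in> polys_over B" "p \<noteq> 0" "poly p f = 0"
  shows "avoiding_chains B (adjoin R f) n"
  unfolding avoiding_chains_def
proof
  fix q assume q: "q \<in> B - {0}"
  have c: "lead_coeff p \<in> B" using p(1) by (simp add: polys_over_def)
  have "lead_coeff p * q \<in> B - {0}" using c p(2) q is_subringD(4)[OF B(1)] by auto
  then obtain P where P: "prime_chain R n P" "lead_coeff p * q \<notin> P n"
    using B(3) unfolding avoiding_chains_def by blast
  have PI: "ideal_in R (P n)" using P(1) by (simp add: prime_chain_def prime_in_def)
  have "lead_coeff p \<notin> P n" "q \<notin> P n"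
    using P(2) ideal_inD(4,5)[OF PI] c q B(2) by auto
  moreover have "p \<in> polys_over R" using p(1) B(2) by (auto simp: polys_over_def)
  ultimately obtain Q where Q: "prime_chain (adjoin R f) n Q" "\<forall>i\<le>n. Q i \<inter> R = P i"
    using going_up_chain[OF R _ p(3) P(1)] by auto
  have "q \<notin> Q n" using Q(2) \<open>q \<notin> P n\<close> q B(2) by auto
  with Q(1) show "\<exists>Q. prime_chain (adjoin R f) n Q \<and> q \<notin> Q n" by auto
qed

section \<open>Extending primes to a polynomial ring\<close>

lemma polys_over_zero: "0 \<in> S \<Longrightarrow> 0 \<in> polys_over S"
  by (simp add: polys_over_def)

lemma polys_over_top_coeff:
  assumes "0 \<in> P" "a \<notin> polys_over P"
  obtains i where "coeff a i \<notin> P" "\<And>k. k > i \<Longrightarrow> coeff a k \<in> P"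
proof -
  define A where "A = {i. coeff a i \<notin> P}"
  have "A \<subseteq> {..degree a}"
    unfolding A_def using assms(1) by (auto intro: le_degree)
  then have fin: "finite A" by (rule finite_subset) simp
  have "A \<noteq> {}" using assms(2) by (auto simp: A_def polys_over_def)
  then have "coeff a (Max A) \<notin> P" using Max_in[OF fin] by (auto simp: A_def)
  moreover have "coeff a k \<in> P" if "k > Max A" for k
    using that Max_ge[OF fin, of k] by (force simp: A_def)
  ultimately show ?thesis by (rule that)
qed

text \<open>Modulo \<open>P\<close> the indices \<open>i\<close> and \<open>j\<close> are the
  degrees of \<open>a\<close> and \<open>b\<close>, and leading coefficients multiply because R / P
  is a domain.\<close>

lemma prime_in_top_coeff_mult:
  assumes P: "prime_in R P" and "a \<in> polys_over R" "b \<in> polys_over R" and R: "is_subring R"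
    and a: "coeff a i \<notin> P" "\<And>k. k > i \<Longrightarrow> coeff a k \<in> P"
    and b: "coeff b j \<notin> P" "\<And>k. k > j \<Longrightarrow> coeff b k \<in> P"
  shows "coeff (a * b) (i + j) \<notin> P"
proof
  note PI = prime_inD(1)[OF P]
  assume *: "coeff (a * b) (i + j) \<in> P"
  have aR: "coeff a k \<in> R" and bR: "coeff b k \<in> R" for k using assms(2,3) by (auto simp: polys_over_def)
  have "coeff (a * b) (i + j) =
      coeff a i * coeff b j + (\<Sum>k\<in>{..i + j} - {i}. coeff a k * coeff b (i + j - k))"
    unfolding coeff_mult by (subst sum.remove[of _ i]) auto
  moreover have sum: "(\<Sum>k\<in>{..i + j} - {i}. coeff a k * coeff b (i + j - k)) \<in> P"
  proof (rule ideal_in_sum[OF PI])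
    fix k assume k: "k \<in> {..i + j} - {i}"
    then consider "k > i" | "i + j - k > j" by fastforce
    then show "coeff a k * coeff b (i + j - k) \<in> P"
      by cases (rule ideal_inD(5)[OF PI bR a(2)] ideal_inD(4)[OF PI aR b(2)], assumption)+
  qed
  ultimately have "coeff a i * coeff b j \<in> P" using ideal_in_diff[OF R PI * sum] by simp
  then show False using prime_inD(3)[OF P aR bR] a(1) b(1) by blast
qed

lemma prime_in_polys_over:
  assumes "is_subring R" "prime_in R P"
  shows "prime_in (polys_over R) (polys_over P)"
  unfolding prime_in_def
proof (intro conjI ballI impI)
  note PI = prime_inD(1)[OF assms(2)]
  show "ideal_in (polys_over R) (polys_over P)" by (rule ideal_in_polys_over[OF assms(1) PI])
  show "1 \<notin> polys_over P" using prime_inD(2)[OF assms(2)] by (auto simp: polys_over_def intro!: exI[of _ 0])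
  fix a b assume ab: "a \<in> polys_over R" "b \<in> polys_over R" "a * b \<in> polys_over P"
  show "a \<in> polys_over P \<or> b \<in> polys_over P"
  proof (rule ccontr)
    assume "\<not> (a \<in> polys_over P \<or> b \<in> polys_over P)"
    then have "a \<notin> polys_over P" "b \<notin> polys_over P" by auto
    then obtain i j where "coeff a i \<notin> P" "\<And>k. k > i \<Longrightarrow> coeff a k \<in> P"
      "coeff b j \<notin> P" "\<And>k. k > j \<Longrightarrow> coeff b k \<in> P"
      using polys_over_top_coeff[OF ideal_inD(2)[OF PI]] by metis
    from prime_in_top_coeff_mult[OF assms(2) ab(1,2) assms(1) this] ab(3)
    show False by (simp add: polys_over_def)
  qed
qed

definition transcendental_over :: "'r::comm_ring_1 set \<Rightarrow> 'r \<Rightarrow> bool" where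
  "transcendental_over R y \<longleftrightarrow> (\<forall>p\<in>polys_over R. poly p y = 0 \<longrightarrow> p = 0)"

lemma transcendental_over_inj:
  assumes "is_subring R" "transcendental_over R y" "p \<in> polys_over R" "q \<in> polys_over R" "poly p y = poly q y"
  shows "p = q"
proof -
  have "p - q \<in> polys_over R" by (rule is_subringD(6)[OF is_subring_polys_over[OF assms(1)] assms(3,4)])
  moreover have "poly (p - q) y = 0" using assms(5) by simp
  ultimately show ?thesis using assms(2) by (auto simp: transcendental_over_def)
qed

text \<open>Evaluation at a transcendental \<open>y\<close> is injective, so membership in an
  extended ideal of R[y] can be read off the coefficients.\<close>

lemma transcendental_over_poly_in_adjoin:
  assumes "is_subring R" "transcendental_over R y" "I \<subseteq> R" "p \<in> polys_over R" "poly p y \<in> adjoin I y"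
  shows "p \<in> polys_over I"
proof -
  obtain q where q: "q \<in> polys_over I" "poly p y = poly q y" using assms(5) by (rule adjoinE)
  then have "q \<in> polys_over R" using assms(3) by (auto simp: polys_over_def)
  then have "p = q" using transcendental_over_inj[OF assms(1,2,4)] q(2) by simp
  with q(1) show ?thesis by simp
qed

lemma prime_in_adjoin:
  assumes R: "is_subring R" and y: "transcendental_over R y" and P: "prime_in R P"
  shows "prime_in (adjoin R y) (adjoin P y)"
  unfolding prime_in_def
proof (intro conjI ballI impI)
  note PI = prime_inD(1)[OF P]
  have PR: "P \<subseteq> R" using ideal_inD(1)[OF PI] by auto
  note P' = prime_in_polys_over[OF R P]
  show "ideal_in (adjoin R y) (adjoin P y)" by (rule ideal_in_adjoin[OF R PI])
  show "1 \<notin> adjoin P y"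
    using transcendental_over_poly_in_adjoin[OF R y PR is_subringD(2)[OF is_subring_polys_over[OF R]]]
      prime_inD(2)[OF P'] by auto
  fix a b assume "a \<in> adjoin R y" "b \<in> adjoin R y" and ab: "a * b \<in> adjoin P y"
  then obtain p q where pq: "p \<in> polys_over R" "q \<in> polys_over R" "a = poly p y" "b = poly q y"
    by (elim adjoinE)
  have "p * q \<in> polys_over P"
    using ab by (intro transcendental_over_poly_in_adjoin[OF R y PR]
        is_subringD(4)[OF is_subring_polys_over[OF R]] pq(1,2)) (simp add: pq)
  then have "p \<in> polys_over P \<or> q \<in> polys_over P" using prime_inD(3)[OF P'] pq(1,2) by simp
  then show "a \<in> adjoin P y \<or> b \<in> adjoin P y" by (auto simp: pq intro: adjoinI)
qed

text \<open>The new prime on top of \<open>P\<^sub>n[y]\<close> contains \<open>1 + y q\<close>, modulo which \<open>q\<close> is a unit.\<close>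

lemma avoiding_chains_transcendental:
  assumes R: "is_subring R" and y: "transcendental_over R y" and chains: "avoiding_chains R R n"
  shows "avoiding_chains (adjoin R y) (adjoin R y) (Suc n)"
  unfolding avoiding_chains_def
proof
  fix q assume q: "q \<in> adjoin R y - {0}"
  then obtain p where p: "p \<in> polys_over R" "q = poly p y" by (auto elim: adjoinE)
  then have "p \<noteq> 0" using q by auto
  then have "lead_coeff p \<in> R - {0}" using p(1) by (auto simp: polys_over_def)
  \<comment> \<open>With the leading coefficient avoided, \<open>1 + [:0, 1:] * p\<close> has the
    positive degree \<open>Suc (degree p)\<close> modulo \<open>P n\<close>. Hence
    \<open>1 + y * q\<close> is neither zero nor a unit modulo the extension of \<open>P n\<close>;
    the former makes the last inclusion strict, the latter makes \<open>N\<close> proper.\<close>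
  then obtain P where P: "prime_chain R n P" "lead_coeff p \<notin> P n"
    using chains unfolding avoiding_chains_def by blast
  have Pi: "prime_in R (P i)" "P i \<subseteq> R" if "i \<le> n" for i
    using P(1) that by (simp_all add: prime_chain_def prime_in_def ideal_in_def)
  note R' = is_subring_adjoin[OF R, of y]
  note Q = prime_in_adjoin[OF R y Pi(1)]
  note QI = prime_inD(1)[OF Q[OF order.refl]]
  have T: "1 + y * q = poly (1 + [:0, 1:] * p) y" "1 + [:0, 1:] * p \<in> polys_over R"
    using p is_subringD(2-4)[OF is_subring_polys_over[OF R]] is_subringD(1,2)[OF R]
    by (simp_all add: polys_over_pCons polys_over_zero)
  have "1 + y * q \<in> adjoin R y" unfolding T(1) by (rule adjoinI[OF T(2)])
  note NI = ideal_in_principal[OF R' this]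
  define N where "N = {w + h | w h. w \<in> adjoin (P n) y \<and> h \<in> (*) (1 + y * q) ` adjoin R y}"
  have N: "ideal_in (adjoin R y) N" unfolding N_def by (rule ideal_in_sum_set[OF R' QI NI])
  have N1: "1 + y * q \<in> N"
  proof -
    have "1 + y * q = 0 + (1 + y * q) * 1" by simp
    then show ?thesis unfolding N_def using ideal_inD(2)[OF QI] is_subringD(2)[OF R'] by fast
  qed
  have coeff_T: "coeff (1 + [:0, 1:] * p) (Suc k) = coeff p k" for k by (simp add: coeff_1)
  have "1 \<notin> N"
  proof
    note PI = prime_inD(1)[OF Pi(1)[OF order.refl]]
    assume "1 \<in> N"
    then obtain u h where uh: "u \<in> polys_over (P n)" "h \<in> polys_over R" "1 = poly u y + (1 + y * q) * poly h y"
    proof -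
      from \<open>1 \<in> N\<close> obtain w h where "w \<in> adjoin (P n) y" "h \<in> adjoin R y" "1 = w + (1 + y * q) * h"
        unfolding N_def by auto
      then show ?thesis using that by (auto elim!: adjoinE)
    qed
    have uR: "u \<in> polys_over R" using uh(1) Pi(2)[OF order.refl] by (auto simp: polys_over_def)
    have eq: "1 = u + (1 + [:0, 1:] * p) * h"
    proof (rule transcendental_over_inj[OF R y])
      note * = is_subringD[OF is_subring_polys_over[OF R]]
      show "1 \<in> polys_over R" by (rule *(2))
      show "u + (1 + [:0, 1:] * p) * h \<in> polys_over R" by (rule *(3)[OF uR *(4)[OF T(2) uh(2)]])
      show "poly 1 y = poly (u + (1 + [:0, 1:] * p) * h) y" using uh(3) T(1) by simp
    qed
    have "h \<notin> polys_over (P n)"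
    proof
      assume "h \<in> polys_over (P n)"
      from ideal_inD(3)[OF ideal_in_polys_over[OF R PI] uh(1) polys_over_mult[OF R PI T(2) this]]
      have "1 \<in> polys_over (P n)" unfolding eq[symmetric] .
      then show False using prime_inD(2)[OF prime_in_polys_over[OF R Pi(1)[OF order.refl]]] by simp
    qed
    then obtain j where j: "coeff h j \<notin> P n" "\<And>k. k > j \<Longrightarrow> coeff h k \<in> P n"
      using polys_over_top_coeff[OF ideal_inD(2)[OF PI]] by metis
    have *: "coeff (1 + [:0, 1:] * p) k \<in> P n" if "k > Suc (degree p)" for k
      using that ideal_inD(2)[OF PI] by (cases k) (auto simp: coeff_T coeff_eq_0)
    \<comment> \<open>This index is the degree of the product modulo \<open>P n\<close>. It is
      positive, so \<open>1\<close> contributes nothing there and only a coefficient of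
      \<open>u\<close> could balance it.\<close>
    have "coeff ((1 + [:0, 1:] * p) * h) (Suc (degree p) + j) \<notin> P n"
      using P(2) by (intro prime_in_top_coeff_mult[OF Pi(1)[OF order.refl] T(2) uh(2) R _ * j]) (simp_all add: coeff_T)
    moreover have "coeff ((1 + [:0, 1:] * p) * h) (Suc (degree p) + j) = - coeff u (Suc (degree p) + j)"
    proof -
      have "(1 + [:0, 1:] * p) * h = 1 - u" using eq by (simp add: algebra_simps)
      then show ?thesis by (simp add: coeff_1)
    qed
    moreover have "- coeff u (Suc (degree p) + j) \<in> P n"
      using uh(1) by (intro ideal_in_uminus[OF R PI]) (simp add: polys_over_def)
    ultimately show False by simp
  qed
  \<comment> \<open>Modulo \<open>N\<close> the element \<open>q\<close> has the inverse
    \<open>- y\<close>, so a power of \<open>q\<close> in \<open>N\<close> could be lowered down to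
    \<open>1\<close>.\<close>
  have "q ^ k \<notin> N" for k
  proof (induction k)
    case 0
    then show ?case using \<open>1 \<notin> N\<close> by simp
  next
    case (Suc k)
    show ?case
    proof
      assume *: "q ^ Suc k \<in> N"
      have qk: "q ^ k \<in> adjoin R y" using q is_subring_power[OF R'] by simp
      have "q ^ k * (1 + y * q) - y * q ^ Suc k \<in> N"
        using ideal_in_diff[OF R' N ideal_inD(4)[OF N qk N1] ideal_inD(4)[OF N adjoin_self[OF R] *]] .
      then show False using Suc by (simp add: algebra_simps)
    qed
  qed
  define S where "S = range (\<lambda>k. q ^ k)"
  have S: "S \<subseteq> adjoin R y" "N \<inter> S = {}"
    using q is_subring_power[OF R'] \<open>\<And>k. q ^ k \<notin> N\<close> by (auto simp: S_def)
  have S1: "1 \<in> S" unfolding S_def by (rule image_eqI[of _ _ 0]) simp_all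
  have Sm: "a * b \<in> S" if "a \<in> S" "b \<in> S" for a b
    using that by (auto simp: S_def simp flip: power_add)
  obtain Q' where Q': "prime_in (adjoin R y) Q'" "N \<subseteq> Q'" "Q' \<inter> S = {}"
    using exists_prime_avoiding[OF R' N S(1) S1 Sm S(2)] .
  have "q \<notin> Q'"
  proof
    assume "q \<in> Q'"
    moreover have "q \<in> S" unfolding S_def by (rule image_eqI[of _ _ 1]) simp_all
    ultimately show False using Q'(3) by auto
  qed
  define Q2 where "Q2 = (\<lambda>i. if i \<le> n then adjoin (P i) y else Q')"
  have "prime_chain (adjoin R y) (Suc n) Q2"
    unfolding prime_chain_def
  proof (intro conjI allI impI)
    fix i assume "i \<le> Suc n"
    then show "prime_in (adjoin R y) (Q2 i)" using Q Q'(1) by (auto simp: Q2_def)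
  next
    fix i assume i: "i < Suc n"
    show "Q2 i \<subset> Q2 (Suc i)"
    proof (cases "i = n")
      case True
      have "adjoin (P n) y \<subseteq> N"
      proof
        fix w assume "w \<in> adjoin (P n) y"
        moreover have "w = w + (1 + y * q) * 0" by simp
        ultimately show "w \<in> N" unfolding N_def using is_subringD(1)[OF R'] by fast
      qed
      moreover have "1 + y * q \<notin> adjoin (P n) y"
      proof
        assume "1 + y * q \<in> adjoin (P n) y"
        then have "1 + [:0, 1:] * p \<in> polys_over (P n)"
          using transcendental_over_poly_in_adjoin[OF R y Pi(2)[OF order.refl] T(2)] by (simp add: T(1))
        then have "coeff (1 + [:0, 1:] * p) (Suc (degree p)) \<in> P n"
          unfolding polys_over_def mem_Collect_eq by (rule spec)
        then show False using P(2) unfolding coeff_T by simp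
      qed
      ultimately show ?thesis using Q'(2) N1 True by (auto simp: Q2_def)
    next
      case False
      then have i: "i < n" using i by simp
      then have lt: "P i \<subset> P (Suc i)" using P(1) by (simp add: prime_chain_def)
      then obtain x where x: "x \<in> P (Suc i)" "x \<notin> P i" by auto
      have "adjoin (P i) y \<subseteq> adjoin (P (Suc i)) y" using lt by (auto simp: adjoin_def polys_over_def)
      moreover have "x \<in> adjoin (P (Suc i)) y"
        using x(1) subset_adjoin ideal_inD(2)[OF prime_inD(1)[OF Pi(1)[of "Suc i"]]] i by auto
      moreover have "x \<notin> adjoin (P i) y"
      proof
        assume "x \<in> adjoin (P i) y"
        moreover have "[:x:] \<in> polys_over R"
          using x(1) Pi(2)[of "Suc i"] i is_subringD(1)[OF R] by (auto simp: polys_over_def coeff_pCons split: nat.splits)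
        ultimately have "[:x:] \<in> polys_over (P i)"
          using transcendental_over_poly_in_adjoin[OF R y Pi(2)[of i]] i by simp
        then show False using x(2) by (simp add: polys_over_pCons)
      qed
      ultimately show ?thesis using i by (auto simp: Q2_def)
    qed
  qed
  then show "\<exists>Q. prime_chain (adjoin R y) (Suc n) Q \<and> q \<notin> Q (Suc n)"
    using \<open>q \<notin> Q'\<close> by (intro exI[of _ Q2]) (simp add: Q2_def)
qed

text \<open>If \<open>c + a * poly p a\<close> is in \<open>P\<close>, then \<open>c\<close> lies in
  \<open>P'\<close> and in \<open>B\<close>, hence is zero, and \<open>a\<close> can be cancelled
  modulo \<open>P\<close>. Allowing a value in \<open>P\<close> instead of only 0 yields two things
  at once: \<open>a\<close> is transcendental over \<open>B\<close>, and \<open>P\<close> meets B[a]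
  trivially, which is the hypothesis for the next lower prime.\<close>

lemma transcendental_over_prime_step:
  fixes a :: "'r::idom"
  assumes A: "is_subring A" and B: "is_subring B" "B \<subseteq> A"
    and P: "prime_in A P" and P': "prime_in A P'" "P \<subseteq> P'" "P' \<inter> B \<subseteq> {0}" and a: "a \<in> P'" "a \<notin> P"
    and p: "p \<in> polys_over B" "poly p a \<in> P"
  shows "p = 0"
proof -
  note PI = prime_inD(1)[OF P] and PI' = prime_inD(1)[OF P'(1)]
  have aA: "a \<in> A" by (rule ideal_inD(1)[OF PI' a(1)])
  show ?thesis using p
  proof (induction p)
    case (pCons c p)
    have c: "c \<in> B" and pB: "p \<in> polys_over B" using pCons.prems(1) by (auto simp: polys_over_pCons)
    have pa: "poly p a \<in> A" using adjoin_subset[OF A B(2) aA] adjoinI[OF pB] by blast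
    have "a * poly p a \<in> P'" by (rule ideal_inD(5)[OF PI' pa a(1)])
    moreover have "c + a * poly p a \<in> P'" using pCons.prems(2) P'(2) by auto
    ultimately have "c + a * poly p a - a * poly p a \<in> P'" by (intro ideal_in_diff[OF A PI'])
    then have "c = 0" using c P'(3) by auto
    then have "a * poly p a \<in> P" using pCons.prems(2) by simp
    then have "poly p a \<in> P" using prime_inD(3)[OF P aA pa] a(2) by blast
    then have "p = 0" using pCons.IH pB by blast
    then show ?case using \<open>c = 0\<close> by simp
  qed simp
qed

lemma prime_chain_imp_avoiding_chains:
  fixes F :: "'r::idom set"
  assumes F: "is_subring F" "\<And>x. x \<in> F \<Longrightarrow> x \<noteq> 0 \<Longrightarrow> \<exists>y\<in>F. x * y = 1"
    and A: "is_subring A" "F \<subseteq> A" and P: "prime_chain A n P"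
  obtains B where "is_subring B" "F \<subseteq> B" "B \<subseteq> A" "avoiding_chains B B n"
proof -
  \<comment> \<open>The chain is descended from \<open>P n\<close>, and each step adjoins one
    element of the difference of two neighbours. The last clause is the invariant that makes the
    next such element transcendental.\<close>
  have "\<exists>B. is_subring B \<and> F \<subseteq> B \<and> B \<subseteq> A \<and> avoiding_chains B B k \<and> P (n - k) \<inter> B \<subseteq> {0}" if "k \<le> n" for k
    using that
  proof (induction k)
    case 0
    have Pn: "prime_in A (P n)" using P by (simp add: prime_chain_def)
    have "P n \<inter> F \<subseteq> {0}"
    proof (rule ccontr)
      assume "\<not> P n \<inter> F \<subseteq> {0}"
      then obtain x y where "x \<in> P n" "y \<in> F" "x * y = 1" using F(2) by blast
      then show False using ideal_inD(5)[OF prime_inD(1)[OF Pn], of y x] prime_inD(2)[OF Pn] A(2) by auto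
    qed
    moreover have "avoiding_chains F F 0"
      unfolding avoiding_chains_def prime_chain_def using prime_in_zero[OF F(1)]
      by (auto intro!: exI[of _ "\<lambda>_. {0}"])
    ultimately show ?case using F(1) A(2) by auto
  next
    case (Suc k)
    then obtain B where B: "is_subring B" "F \<subseteq> B" "B \<subseteq> A" "avoiding_chains B B k" "P (n - k) \<inter> B \<subseteq> {0}"
      by auto
    define i where "i = n - Suc k"
    have ni: "n - k = Suc i" using Suc.prems by (simp add: i_def)
    have PP: "prime_in A (P i)" "prime_in A (P (Suc i))" "P i \<subset> P (Suc i)"
      using P Suc.prems by (auto simp: prime_chain_def i_def)
    then obtain a where a: "a \<in> P (Suc i)" "a \<notin> P i" by auto
    have aA: "a \<in> A" by (rule ideal_inD(1)[OF prime_inD(1)[OF PP(2)] a(1)])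
    have B5: "P (Suc i) \<inter> B \<subseteq> {0}" using B(5) ni by simp
    note step = transcendental_over_prime_step[OF A(1) B(1,3) PP(1,2) psubset_imp_subset[OF PP(3)] B5 a]
    have "transcendental_over B a"
      unfolding transcendental_over_def using step ideal_inD(2)[OF prime_inD(1)[OF PP(1)]] by auto
    from avoiding_chains_transcendental[OF B(1) this B(4)]
    have "avoiding_chains (adjoin B a) (adjoin B a) (Suc k)" .
    moreover have "P (n - Suc k) \<inter> adjoin B a \<subseteq> {0}"
      unfolding i_def[symmetric]
    proof
      fix x assume x: "x \<in> P i \<inter> adjoin B a"
      then obtain p where "p \<in> polys_over B" "x = poly p a" by (auto elim: adjoinE)
      with step[of p] x show "x \<in> {0}" by simp
    qed
    moreover have "F \<subseteq> adjoin B a" using B(2) subset_adjoin[OF is_subringD(1)[OF B(1)]] by (rule order.trans)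
    ultimately show ?case
      using is_subring_adjoin[OF B(1)] adjoin_subset[OF A(1) B(3) aA] by (intro exI[of _ "adjoin B a"] conjI)
  qed
  from this[OF order.refl] that show ?thesis by blast
qed

text \<open>Each \<open>f\<close> is algebraic over \<open>B\<close> itself and not just over the
  ring built so far; thus every leading coefficient lies in \<open>B\<close>, from which the avoided
  elements are taken.\<close>

lemma avoiding_chains_algebraic_hull:
  fixes B :: "'r::idom set"
  assumes B: "is_subring B" "avoiding_chains B B n"
  shows "finite T \<Longrightarrow> (\<And>f. f \<in> T \<Longrightarrow> \<not> transcendental_over B f) \<Longrightarrow>
    avoiding_chains B (is_subring hull (B \<union> T)) n"
proof (induction T rule: finite_induct)
  case empty
  then show ?case using B by (simp add: hull_same)
next
  case (insert f T)
  define R where "R = is_subring hull (B \<union> T)"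
  have "is_subring hull (B \<union> insert f T) = is_subring hull (insert f R)"
    unfolding R_def by (simp flip: hull_insert)
  also have "\<dots> = adjoin R f" unfolding R_def by (simp add: adjoin_eq_hull is_subring_hull)
  finally have "is_subring hull (B \<union> insert f T) = adjoin R f" .
  moreover obtain p where "p \<in> polys_over B" "poly p f = 0" "p \<noteq> 0"
    using insert.prems[of f] by (auto simp: transcendental_over_def)
  moreover have "is_subring R" unfolding R_def by (rule is_subring_hull)
  moreover have "B \<subseteq> R" unfolding R_def by (meson hull_subset le_sup_iff)
  moreover have "avoiding_chains B R n" unfolding R_def using insert by simp
  ultimately show ?case using avoiding_chains_algebraic[OF _ B(1)] by metis
qed

text \<open>Transcendental members of \<open>T\<close> are moved into \<open>B\<close> until all of
  \<open>T\<close> is algebraic over it. Each move would allow a chain longer by one; the surplus is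
  cut off.\<close>

lemma avoiding_chains_hull:
  fixes B :: "'r::idom set"
  assumes "finite T" "is_subring B" "avoiding_chains B B n"
  shows "\<exists>P. prime_chain (is_subring hull (B \<union> T)) n P"
  using assms(2,3)
proof (induction "card (T - B)" arbitrary: B rule: less_induct)
  case less
  show ?case
  proof (cases "\<exists>f\<in>T. transcendental_over B f")
    case True
    then obtain f where f: "f \<in> T" "transcendental_over B f" by blast
    \<comment> \<open>Elements of \<open>B\<close> are roots of monic linear polynomials over
      \<open>B\<close>. So the adjunction of \<open>f\<close> lowers
      \<open>card (T - B)\<close>.\<close>
    have "f \<notin> B"
    proof
      assume "f \<in> B"
      then have "[:-f, 1:] \<in> polys_over B"
        using is_subringD[OF less.prems(1)] by (simp add: polys_over_pCons) (simp add: polys_over_def)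
      then show False using f(2) by (auto simp: transcendental_over_def)
    qed
    define C where "C = adjoin B f"
    have C: "B \<subseteq> C" "f \<in> C"
      unfolding C_def using subset_adjoin is_subringD(1)[OF less.prems(1)] adjoin_self[OF less.prems(1)] by auto
    have "card (T - C) < card (T - B)"
      using assms(1) f(1) \<open>f \<notin> B\<close> C by (intro psubset_card_mono) auto
    moreover have "avoiding_chains C C n"
      unfolding C_def using avoiding_chains_transcendental[OF less.prems(1) f(2) less.prems(2)]
      by (rule avoiding_chains_mono) simp
    ultimately have "\<exists>P. prime_chain (is_subring hull (C \<union> T)) n P"
      using less.hyps[of C] is_subring_adjoin[OF less.prems(1)] unfolding C_def by simp
    moreover have "is_subring hull (C \<union> T) = is_subring hull (B \<union> T)"
      unfolding C_def adjoin_eq_hull[OF less.prems(1)] using f(1)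
      by (simp flip: hull_Un_left add: insert_absorb)
    ultimately show ?thesis by simp
  next
    case False
    then have "avoiding_chains B (is_subring hull (B \<union> T)) n"
      using avoiding_chains_algebraic_hull[OF less.prems assms(1)] by blast
    \<comment> \<open>Only the chain itself matters from here on, so \<open>1\<close> serves as the
      element to avoid.\<close>
    moreover have "1 \<in> B - {0}" using is_subringD(2)[OF less.prems(1)] by simp
    ultimately show ?thesis unfolding avoiding_chains_def by blast
  qed
qed

theorem prime_chain_subalgebra:
  fixes F :: "'r::idom set"
  assumes F: "is_subring F" "\<And>x. x \<in> F \<Longrightarrow> x \<noteq> 0 \<Longrightarrow> \<exists>y\<in>F. x * y = 1"
    and A: "is_subring A" "F \<subseteq> A" "A \<subseteq> is_subring hull (F \<union> T)" and "finite T"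
    and P: "prime_chain A n P"
  obtains P' where "prime_chain (is_subring hull (F \<union> T)) n P'"
proof -
  obtain B where B: "is_subring B" "F \<subseteq> B" "B \<subseteq> A" "avoiding_chains B B n"
    using prime_chain_imp_avoiding_chains[OF F A(1,2) P] by blast
  \<comment> \<open>\<open>B\<close> lies between \<open>F\<close> and the ring generated by
    \<open>F\<close> and \<open>T\<close>, so replacing \<open>F\<close> by \<open>B\<close> does
    not change what is generated together with \<open>T\<close>.\<close>
  have "B \<union> T \<subseteq> is_subring hull (F \<union> T)" using B(3) A(3) by (auto intro: hull_inc)
  then have "is_subring hull (B \<union> T) \<subseteq> is_subring hull (F \<union> T)"
    by (rule hull_minimal) (rule is_subring_hull)
  moreover have "is_subring hull (F \<union> T) \<subseteq> is_subring hull (B \<union> T)" using B(2) by (intro hull_mono) auto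
  ultimately have "is_subring hull (F \<union> T) = is_subring hull (B \<union> T)" by simp
  then show ?thesis using avoiding_chains_hull[OF \<open>finite T\<close> B(1,4)] that by auto
qed

section \<open>Krull dimension of subalgebras\<close>

definition ring_on :: "'r::comm_ring_1 set \<Rightarrow> 'r ring" where
  "ring_on A = \<lparr>carrier = A, mult = (*), one = 1, zero = 0, add = (+)\<rparr>"

lemma ring_on_simps [simp]:
  "carrier (ring_on A) = A" "x \<otimes>\<^bsub>ring_on A\<^esub> y = x * y" "\<one>\<^bsub>ring_on A\<^esub> = 1"
  "\<zero>\<^bsub>ring_on A\<^esub> = 0" "x \<oplus>\<^bsub>ring_on A\<^esub> y = x + y"
  by (simp_all add: ring_on_def)

lemma cring_ring_on:
  assumes "is_subring A"
  shows "cring (ring_on A)"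
proof (rule cringI)
  note A = is_subringD[OF assms]
  show "abelian_group (ring_on A)"
  proof (rule abelian_groupI)
    fix x assume "x \<in> carrier (ring_on A)"
    then show "\<exists>y\<in>carrier (ring_on A). y \<oplus>\<^bsub>ring_on A\<^esub> x = \<zero>\<^bsub>ring_on A\<^esub>"
      by (auto intro!: bexI[of _ "- x"] A)
  qed (auto intro: A simp: add_ac)
  show "Group.comm_monoid (ring_on A)"
    by (rule comm_monoidI) (auto intro: A simp: mult_ac)
qed (auto simp: distrib_right)

lemma ideal_ring_on:
  assumes A: "is_subring A"
  shows "ideal I (ring_on A) \<longleftrightarrow> ideal_in A I"
proof
  assume I: "ideal I (ring_on A)"
  interpret ideal I "ring_on A" by (rule I)
  show "ideal_in A I"
    unfolding ideal_in_def
    using a_subset additive_subgroup.zero_closed[OF is_additive_subgroup]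
      additive_subgroup.a_closed[OF is_additive_subgroup] I_l_closed by auto
next
  assume I: "ideal_in A I"
  interpret cring "ring_on A" by (rule cring_ring_on[OF A])
  show "ideal I (ring_on A)"
  proof (rule idealI)
    show "ring (ring_on A)" by (rule ring_axioms)
    have "inv\<^bsub>add_monoid (ring_on A)\<^esub> x = - x" if "x \<in> A" for x
      using that is_subringD[OF A] minus_equality[of "- x" x] by (simp add: a_inv_def)
    then show "subgroup I (add_monoid (ring_on A))"
      using ideal_inD[OF I] ideal_in_uminus[OF A I] by (auto simp: subgroup_def)
  qed (use ideal_inD[OF I] in auto)
qed

lemma primeideal_ring_on:
  assumes A: "is_subring A"
  shows "primeideal P (ring_on A) \<longleftrightarrow> prime_in A P"
proof
  assume P: "primeideal P (ring_on A)"
  interpret primeideal P "ring_on A" by (rule P)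
  have "1 \<notin> P" using one_imp_carrier I_notcarr by auto
  then show "prime_in A P"
    using I_prime ideal_axioms unfolding prime_in_def by (auto simp: ideal_ring_on[OF A])
next
  assume P: "prime_in A P"
  show "primeideal P (ring_on A)"
    by (rule primeidealI)
      (use P A is_subringD(2)[OF A] in \<open>auto simp: ideal_ring_on prime_in_def cring_ring_on\<close>)
qed

lemma krull_dim_ring_on:
  assumes "is_subring A"
  shows "krull_dim (ring_on A) = Sup {enat n | n. \<exists>P. prime_chain A n P}"
  unfolding krull_dim_def prime_chain_def primeideal_ring_on[OF assms] ..

theorem krull_dim_subalgebra_mono:
  fixes F :: "'r::idom set"
  assumes "is_subring F" "\<And>x. x \<in> F \<Longrightarrow> x \<noteq> 0 \<Longrightarrow> \<exists>y\<in>F. x * y = 1"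
    and "is_subring A" "F \<subseteq> A" "A \<subseteq> is_subring hull (F \<union> T)" and "finite T"
  shows "krull_dim (ring_on A) \<le> krull_dim (ring_on (is_subring hull (F \<union> T)))"
  unfolding krull_dim_ring_on[OF assms(3)] krull_dim_ring_on[OF is_subring_hull]
proof (rule Sup_subset_mono, safe)
  fix n P assume "prime_chain A n P"
  then show "\<exists>n'. enat n = enat n' \<and> (\<exists>P. prime_chain (is_subring hull (F \<union> T)) n' P)"
    using prime_chain_subalgebra[OF assms] by metis
qed

text \<open>Primes are pulled back along \<open>h\<close>, and surjectivity of \<open>h\<close>
  keeps the inclusions strict.\<close>

lemma krull_dim_iso_le:
  assumes R: "cring R" and S: "cring S" and h: "h \<in> ring_iso R S"
  shows "krull_dim S \<le> krull_dim R"
  unfolding krull_dim_def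
proof (rule Sup_subset_mono, safe)
  fix n and P :: "nat \<Rightarrow> _"
  assume P: "\<forall>i\<le>n. primeideal (P i) S" "\<forall>i<n. P i \<subset> P (Suc i)"
  have hom: "ring_hom_ring R S h"
    using h R S by (intro ring_hom_ringI2) (auto simp: ring_iso_def cring_def)
  have surj: "h ` carrier R = carrier S" using h by (simp add: ring_iso_def bij_betw_def)
  define Q where "Q = (\<lambda>i. {r \<in> carrier R. h r \<in> P i})"
  have "primeideal (Q i) R" if "i \<le> n" for i
    unfolding Q_def using ring_hom_ring.primeideal_vimage[OF hom R] P(1) that by simp
  moreover have "Q i \<subset> Q (Suc i)" if i: "i < n" for i
  proof -
    obtain x where x: "x \<in> P (Suc i)" "x \<notin> P i" using P(2) i by auto
    have "P (Suc i) \<subseteq> carrier S"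
      using P(1) i by (meson Suc_leI ideal.axioms(1) additive_subgroup.a_subset primeideal.axioms(1))
    then obtain r where "r \<in> carrier R" "x = h r" using x(1) surj by auto
    then have "r \<in> Q (Suc i)" "r \<notin> Q i" using x by (auto simp: Q_def)
    then show ?thesis using P(2) i by (auto simp: Q_def)
  qed
  ultimately show "\<exists>n'. enat n = enat n' \<and>
      (\<exists>P. (\<forall>i\<le>n'. primeideal (P i) R) \<and> (\<forall>i<n'. P i \<subset> P (Suc i)))"
    by auto
qed

lemma krull_dim_iso:
  assumes "cring R" "cring S" "h \<in> ring_iso R S"
  shows "krull_dim S = krull_dim R"
  using krull_dim_iso_le[OF assms] krull_dim_iso_le[OF assms(2,1) ring_iso_set_sym[OF _ assms(3)]] assms(1)
  by (auto simp: cring_def)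

section \<open>Homogeneous components\<close>

definition total_degree :: "('v \<Rightarrow>\<^sub>0 nat) \<Rightarrow> nat" where
  "total_degree t = sum (Poly_Mapping.lookup t) (Poly_Mapping.keys t)"

lemma total_degree_superset:
  assumes "finite S" "Poly_Mapping.keys t \<subseteq> S"
  shows "total_degree t = sum (Poly_Mapping.lookup t) S"
  unfolding total_degree_def using assms by (intro sum.mono_neutral_left) (auto simp: in_keys_iff)

lemma total_degree_add: "total_degree (s + t) = total_degree s + total_degree t"
proof -
  have "total_degree (s + t) = sum (Poly_Mapping.lookup (s + t)) (Poly_Mapping.keys s \<union> Poly_Mapping.keys t)"
    by (intro total_degree_superset) (auto simp: keys_add)
  also have "\<dots> = total_degree s + total_degree t"
    unfolding lookup_add sum.distrib by (intro arg_cong2[where f = "(+)"] total_degree_superset[symmetric]) auto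
  finally show ?thesis .
qed

lemma total_degree_single [simp]: "total_degree (Poly_Mapping.single v n) = n"
  by (cases "n = 0") (simp_all add: total_degree_def)

lemma total_degree_zero [simp]: "total_degree 0 = 0"
  by (simp add: total_degree_def)

lift_definition hom_comp :: "nat \<Rightarrow> ('v, 'f::zero) mpoly \<Rightarrow> ('v, 'f) mpoly" is
  "\<lambda>k f t. f t when total_degree t = k"
  by (rule finite_subset[rotated]) auto

definition homog :: "nat \<Rightarrow> ('v, 'f::zero) mpoly set" where
  "homog k = {p. \<forall>t\<in>Poly_Mapping.keys p. total_degree t = k}"

lemma lookup_hom_comp: "Poly_Mapping.lookup (hom_comp k p) t = (Poly_Mapping.lookup p t when total_degree t = k)"
  by transfer simp

lemma hom_comp_zero [simp]: "hom_comp k 0 = 0"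
  by (rule poly_mapping_eqI) (simp add: lookup_hom_comp)

lemma hom_comp_add: "hom_comp k (p + q) = hom_comp k p + hom_comp k q"
  by (rule poly_mapping_eqI) (simp add: lookup_hom_comp lookup_add when_add_distrib)

lemma hom_comp_uminus: "hom_comp k (- p) = - hom_comp k (p :: ('v, 'f::ab_group_add) mpoly)"
  by (rule poly_mapping_eqI) (simp add: lookup_hom_comp when_uminus_distrib)

lemma hom_comp_sum: "hom_comp k (sum f A) = (\<Sum>a\<in>A. hom_comp k (f a))"
  by (induction A rule: infinite_finite_induct) (simp_all add: hom_comp_add)

lemma homogD: "p \<in> homog k \<Longrightarrow> Poly_Mapping.lookup p t \<noteq> 0 \<Longrightarrow> total_degree t = k"
  by (auto simp: homog_def in_keys_iff)

lemma hom_comp_in_homog: "hom_comp k p \<in> homog k"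
  by (auto simp: homog_def in_keys_iff lookup_hom_comp)

lemma hom_comp_homog:
  assumes "p \<in> homog j"
  shows "hom_comp k p = (if k = j then p else 0)"
proof (rule poly_mapping_eqI)
  fix t
  show "Poly_Mapping.lookup (hom_comp k p) t = Poly_Mapping.lookup (if k = j then p else 0) t"
    using homogD[OF assms, of t] by (cases "Poly_Mapping.lookup p t = 0") (auto simp: lookup_hom_comp)
qed

lemma homog_mult: "p \<in> homog i \<Longrightarrow> q \<in> homog j \<Longrightarrow> p * q \<in> homog (i + j)"
  using keys_mult[of p q] by (fastforce simp: homog_def total_degree_add)

lemma homog_zero [simp]: "0 \<in> homog k"
  by (simp add: homog_def)

lemma homog_add: "p \<in> homog k \<Longrightarrow> q \<in> homog k \<Longrightarrow> p + q \<in> homog k"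
  using keys_add[of p q] by (auto simp: homog_def)

lemma homog_uminus: "p \<in> homog k \<Longrightarrow> - p \<in> homog k" for p :: "('v, 'f::ab_group_add) mpoly"
  by (simp add: homog_def)

lemma homog_const: "Poly_Mapping.single 0 c \<in> homog 0"
  by (simp add: homog_def)

lemma sum_hom_comp:
  assumes "\<And>t. t \<in> Poly_Mapping.keys p \<Longrightarrow> total_degree t \<le> N"
  shows "(\<Sum>k\<le>N. hom_comp k p) = p"
proof (rule poly_mapping_eqI)
  fix t
  show "Poly_Mapping.lookup (\<Sum>k\<le>N. hom_comp k p) t = Poly_Mapping.lookup p t"
    using assms[of t] by (cases "Poly_Mapping.lookup p t = 0")
      (auto simp: lookup_sum lookup_hom_comp when_def in_keys_iff)
qed

lemma hom_comp_eq_0: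
  assumes "\<And>t. t \<in> Poly_Mapping.keys p \<Longrightarrow> total_degree t \<noteq> k"
  shows "hom_comp k p = 0"
proof (rule poly_mapping_eqI)
  fix t
  show "Poly_Mapping.lookup (hom_comp k p) t = Poly_Mapping.lookup 0 t"
    using assms[of t] by (auto simp: lookup_hom_comp in_keys_iff when_def)
qed

lemma finite_hom_comp_support: "finite {k. hom_comp k p \<noteq> 0}"
proof (rule finite_subset)
  show "{k. hom_comp k p \<noteq> 0} \<subseteq> total_degree ` Poly_Mapping.keys p" using hom_comp_eq_0[of p] by (auto simp: image_iff) metis
qed simp

lemma hom_comp_eqI:
  assumes "\<And>k. hom_comp k p = hom_comp k q"
  shows "p = q"
proof (rule poly_mapping_eqI)
  fix t
  have "Poly_Mapping.lookup (hom_comp (total_degree t) p) t = Poly_Mapping.lookup (hom_comp (total_degree t) q) t"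
    by (simp add: assms)
  then show "Poly_Mapping.lookup p t = Poly_Mapping.lookup q t" by (simp add: lookup_hom_comp)
qed

lemma hom_comp_mult:
  fixes p q :: "('v, 'f::comm_ring_1) mpoly"
  shows "hom_comp k (p * q) = (\<Sum>i\<le>k. hom_comp i p * hom_comp (k - i) q)"
proof -
  \<comment> \<open>\<open>N\<close> bounds all degrees in \<open>p\<close> and \<open>q\<close>, so
    both are sums of their components up to \<open>N\<close>; it also bounds \<open>k\<close>, so no
    pair of degrees with sum \<open>k\<close> is cut off.\<close>
  obtain N where N: "k \<le> N" "\<And>t. t \<in> Poly_Mapping.keys p \<union> Poly_Mapping.keys q \<Longrightarrow> total_degree t \<le> N"
  proof
    show "k \<le> k + sum total_degree (Poly_Mapping.keys p \<union> Poly_Mapping.keys q)" by simp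
    show "total_degree t \<le> k + sum total_degree (Poly_Mapping.keys p \<union> Poly_Mapping.keys q)" if "t \<in> Poly_Mapping.keys p \<union> Poly_Mapping.keys q" for t
      using member_le_sum[OF that, of total_degree] by simp
  qed
  have "(\<Sum>i\<le>N. hom_comp i p) = p" "(\<Sum>j\<le>N. hom_comp j q) = q"
    by (rule sum_hom_comp, simp add: N(2))+
  then have "hom_comp k (p * q) = hom_comp k ((\<Sum>i\<le>N. hom_comp i p) * (\<Sum>j\<le>N. hom_comp j q))"
    by (simp only:)
  also have "\<dots> = (\<Sum>i\<le>N. \<Sum>j\<le>N. hom_comp k (hom_comp i p * hom_comp j q))"
    by (simp add: sum_product hom_comp_sum)
  also have "\<dots> = (\<Sum>i\<le>N. \<Sum>j\<le>N. if j = k - i \<and> i \<le> k then hom_comp i p * hom_comp j q else 0)"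
  proof (intro sum.cong refl)
    fix i j
    show "hom_comp k (hom_comp i p * hom_comp j q) =
        (if j = k - i \<and> i \<le> k then hom_comp i p * hom_comp j q else 0)"
      unfolding hom_comp_homog[OF homog_mult[OF hom_comp_in_homog hom_comp_in_homog]]
      by (rule if_cong) auto
  qed
  also have "\<dots> = (\<Sum>i\<le>N. if i \<le> k then hom_comp i p * hom_comp (k - i) q else 0)"
  proof (intro sum.cong refl)
    fix i
    show "(\<Sum>j\<le>N. if j = k - i \<and> i \<le> k then hom_comp i p * hom_comp j q else 0) =
        (if i \<le> k then hom_comp i p * hom_comp (k - i) q else 0)"
      using N(1) by (cases "i \<le> k") simp_all
  qed
  also have "\<dots> = (\<Sum>i\<le>k. hom_comp i p * hom_comp (k - i) q)"
    using N(1) by (intro sum.mono_neutral_cong_right) auto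
  finally show ?thesis .
qed

section \<open>The special fiber ring of an equigenerated ideal\<close>

lemma coset_ring_on: "J +>\<^bsub>ring_on C\<^esub> u = (\<lambda>h. h + u) ` J"
  unfolding a_r_coset_def' by auto

lemma coset_ring_on_zero: "J +>\<^bsub>ring_on C\<^esub> 0 = J"
  unfolding coset_ring_on by simp

lemma coset_ring_on_eq_iff:
  assumes "is_subring C" "ideal_in C J"
  shows "J +>\<^bsub>ring_on C\<^esub> u = J +>\<^bsub>ring_on C\<^esub> v \<longleftrightarrow> u - v \<in> J"
proof
  assume eq: "J +>\<^bsub>ring_on C\<^esub> u = J +>\<^bsub>ring_on C\<^esub> v"
  have "0 + u \<in> J +>\<^bsub>ring_on C\<^esub> u"
    unfolding coset_ring_on using ideal_inD(2)[OF assms(2)] by (rule imageI)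
  then have "0 + u \<in> (\<lambda>h. h + v) ` J" using eq by (simp add: coset_ring_on)
  then show "u - v \<in> J" by auto
next
  assume uv: "u - v \<in> J"
  show "J +>\<^bsub>ring_on C\<^esub> u = J +>\<^bsub>ring_on C\<^esub> v"
    unfolding coset_ring_on
  proof (intro equalityI image_subsetI)
    fix h assume h: "h \<in> J"
    have "h + u = (h + (u - v)) + v" by simp
    then show "h + u \<in> (\<lambda>h. h + v) ` J" using ideal_inD(3)[OF assms(2) h uv] by (rule image_eqI)
    have "h + v = (h - (u - v)) + u" by simp
    then show "h + v \<in> (\<lambda>h. h + u) ` J" using ideal_in_diff[OF assms h uv] by (rule image_eqI)
  qed
qed

lemma finsum_ring_on:
  assumes "is_subring C" "finite B" "\<And>i. i \<in> B \<Longrightarrow> f i \<in> C"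
  shows "finsum (ring_on C) f B = sum f B"
proof -
  interpret cring "ring_on C" by (rule cring_ring_on[OF assms(1)])
  show ?thesis using assms(2,3)
    by (induction B rule: finite_induct) (auto simp: Pi_def)
qed

section \<open>Polynomial rings in chosen variables, and lower bounds on degrees\<close>

definition polys_in :: "'v set \<Rightarrow> ('v, 'f::zero) mpoly set" where
  "polys_in V = {p. \<forall>t\<in>Poly_Mapping.keys p. Poly_Mapping.keys t \<subseteq> V}"

lemma poly_ring_eq: "poly_ring V = ring_on (polys_in V)"
  by (simp add: poly_ring_def ring_on_def polys_in_def)

lemma is_subring_polys_in: "is_subring (polys_in V :: ('v, 'f::comm_ring_1) mpoly set)"
  unfolding is_subring_def
proof (intro conjI ballI)
  fix p q :: "('v, 'f) mpoly" assume pq: "p \<in> polys_in V" "q \<in> polys_in V"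
  show "p + q \<in> polys_in V" using keys_add[of p q] pq unfolding polys_in_def by auto
  show "p * q \<in> polys_in V"
    unfolding polys_in_def
  proof (intro CollectI ballI)
    fix t assume "t \<in> Poly_Mapping.keys (p * q)"
    then obtain a b where "t = a + b" "a \<in> Poly_Mapping.keys p" "b \<in> Poly_Mapping.keys q"
      using keys_mult[of p q] by auto
    then show "Poly_Mapping.keys t \<subseteq> V" using keys_add[of a b] pq unfolding polys_in_def by auto
  qed
qed (auto simp: polys_in_def)

lemma const_in_polys_in: "Poly_Mapping.single 0 c \<in> polys_in V"
  by (simp add: polys_in_def)

lemma var_in_polys_in: "v \<in> V \<Longrightarrow> var v \<in> polys_in V"
  by (simp add: polys_in_def var_def)

text \<open>This is the \<open>k\<close>-th power of the graded maximal ideal, described by terms so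
  that degrees can be read off. It serves as an upper bound for the powers of \<open>I\<close> and
  their products with \<open>M\<close>.\<close>

definition min_degree_ideal :: "'v set \<Rightarrow> nat \<Rightarrow> ('v, 'f::zero) mpoly set" where
  "min_degree_ideal V k = {p \<in> polys_in V. \<forall>t\<in>Poly_Mapping.keys p. k \<le> total_degree t}"

lemma min_degree_ideal_mult:
  fixes p q :: "('v, 'f::comm_ring_1) mpoly"
  assumes "p \<in> min_degree_ideal V i" "q \<in> min_degree_ideal V j"
  shows "p * q \<in> min_degree_ideal V (i + j)"
  unfolding min_degree_ideal_def
proof (intro CollectI conjI ballI)
  show "p * q \<in> polys_in V"
    using assms is_subringD(4)[OF is_subring_polys_in] by (auto simp: min_degree_ideal_def)
  fix t assume "t \<in> Poly_Mapping.keys (p * q)"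
  then obtain a b where "t = a + b" "a \<in> Poly_Mapping.keys p" "b \<in> Poly_Mapping.keys q"
    using keys_mult[of p q] by auto
  then show "i + j \<le> total_degree t"
    using assms by (auto simp: min_degree_ideal_def total_degree_add intro: add_mono)
qed

lemma min_degree_ideal_0: "min_degree_ideal V 0 = polys_in V"
  by (simp add: min_degree_ideal_def)

lemma min_degree_ideal_add:
  fixes p q :: "('v, 'f::comm_ring_1) mpoly"
  assumes "p \<in> min_degree_ideal V k" "q \<in> min_degree_ideal V k"
  shows "p + q \<in> min_degree_ideal V k"
  using assms keys_add[of p q] is_subringD(3)[OF is_subring_polys_in, of p V q]
  by (auto simp: min_degree_ideal_def)

lemma ideal_in_min_degree_ideal:
  "ideal_in (polys_in V :: ('v, 'f::comm_ring_1) mpoly set) (min_degree_ideal V k)"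
  unfolding ideal_in_def
proof (intro conjI ballI)
  fix p q :: "('v, 'f) mpoly"
  assume "p \<in> polys_in V" "q \<in> min_degree_ideal V k"
  then show "p * q \<in> min_degree_ideal V k"
    using min_degree_ideal_mult[of p V 0 q k] by (simp add: min_degree_ideal_0)
qed (auto simp: min_degree_ideal_add, auto simp: min_degree_ideal_def is_subringD[OF is_subring_polys_in])

lemma ideal_prod_ring_onI: "a \<in> K \<Longrightarrow> b \<in> L \<Longrightarrow> a * b \<in> K \<cdot>\<^bsub>ring_on C\<^esub> L"
  using ideal_prod.prod[of a K b L "ring_on C"] by simp

lemma ideal_prod_ring_on_induct [consumes 1, case_names mult add]:
  assumes "x \<in> K \<cdot>\<^bsub>ring_on C\<^esub> L" "\<And>a b. a \<in> K \<Longrightarrow> b \<in> L \<Longrightarrow> P (a * b)"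
    "\<And>x y. P x \<Longrightarrow> P y \<Longrightarrow> P (x + y)"
  shows "P x"
  using assms(1) by (induction rule: ideal_prod.induct) (simp_all add: assms(2,3))

lemma keys_add_nat: "Poly_Mapping.keys (s + t) = Poly_Mapping.keys s \<union> Poly_Mapping.keys (t :: 'v \<Rightarrow>\<^sub>0 nat)"
  by (auto simp: in_keys_iff lookup_add)

text \<open>Once the constant term is removed, every monomial is divisible by a variable from
  \<open>V\<close>. So scalars represent all classes modulo the graded maximal ideal.\<close>

lemma diff_const_in_graded_maximal_ideal:
  fixes p :: "('v, 'f::field) mpoly"
  assumes p: "p \<in> polys_in V"
  shows "p - Poly_Mapping.single 0 (Poly_Mapping.lookup p 0) \<in> graded_maximal_ideal V"
proof -
  interpret cring "ring_on (polys_in V :: ('v, 'f) mpoly set)"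
    by (rule cring_ring_on[OF is_subring_polys_in])
  have sub: "var ` V \<subseteq> carrier (ring_on (polys_in V :: ('v, 'f) mpoly set))" by (auto simp: var_in_polys_in)
  have M: "ideal_in (polys_in V) (graded_maximal_ideal V :: ('v, 'f) mpoly set)"
    using genideal_ideal[OF sub]
    by (simp add: graded_maximal_ideal_def poly_ring_eq ideal_ring_on is_subring_polys_in)
  have var: "var ` V \<subseteq> (graded_maximal_ideal V :: ('v, 'f) mpoly set)"
    using genideal_self[OF sub] by (simp add: graded_maximal_ideal_def poly_ring_eq)
  have mono: "Poly_Mapping.single t c \<in> graded_maximal_ideal V"
    if t: "Poly_Mapping.keys t \<subseteq> V" "t \<noteq> 0" for t and c :: 'f
  proof -
    obtain v where v: "v \<in> Poly_Mapping.keys t" using t(2) by (metis keys_eq_empty ex_in_conv)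
    define s where "s = t - Poly_Mapping.single v 1"
    have ts: "t = s + Poly_Mapping.single v 1"
      using v unfolding s_def
      by (intro poly_mapping_eqI) (auto simp: lookup_add lookup_minus lookup_single when_def in_keys_iff)
    have "Poly_Mapping.single t c = Poly_Mapping.single s c * var v"
      by (simp add: ts var_def mult_single)
    moreover have "Poly_Mapping.single s c \<in> polys_in V"
      using t(1) unfolding ts keys_add_nat by (auto simp: polys_in_def)
    moreover have "var v \<in> (graded_maximal_ideal V :: ('v, 'f) mpoly set)" using var v t(1) by auto
    ultimately show ?thesis using ideal_inD(4)[OF M] by simp
  qed
  define q where "q = p - Poly_Mapping.single 0 (Poly_Mapping.lookup p 0)"
  have "q = (\<Sum>t\<in>Poly_Mapping.keys q. Poly_Mapping.single t (Poly_Mapping.lookup q t))"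
    by (rule poly_mapping_eqI) (auto simp: lookup_sum lookup_single when_def in_keys_iff)
  also have "\<dots> \<in> graded_maximal_ideal V"
  proof (rule ideal_in_sum[OF M], rule mono)
    fix t assume t: "t \<in> Poly_Mapping.keys q"
    then show "t \<noteq> 0" by (auto simp: q_def in_keys_iff lookup_minus)
    then have "t \<in> Poly_Mapping.keys p" using t by (auto simp: q_def in_keys_iff lookup_minus lookup_single)
    then show "Poly_Mapping.keys t \<subseteq> V" using p by (auto simp: polys_in_def)
  qed
  finally show ?thesis unfolding q_def .
qed

text \<open>As \<open>d\<close> is positive, \<open>d * k\<close> determines \<open>k\<close>, so
  the graded pieces of the special fiber ring can be told apart by degree inside one
  polynomial.\<close>

locale equigenerated_ideal =
  fixes V :: "'v set" and X :: "('v, 'f::field) mpoly set" and d :: nat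
  assumes X_in: "X \<subseteq> polys_in V" and X_homog: "X \<subseteq> homog d" and d_pos: "d > 0"
begin

abbreviation R where "R \<equiv> ring_on (polys_in V :: ('v, 'f) mpoly set)"

definition M :: "('v, 'f) mpoly set" where "M = graded_maximal_ideal V"
definition I where "I = genideal R X"
definition pow where "pow k = ideal_power R I k"
definition J where "J k = M \<cdot>\<^bsub>R\<^esub> pow k"
definition A :: "('v, 'f) mpoly set" where "A = is_subring hull (range (Poly_Mapping.single 0) \<union> X)"

lemmas S = is_subring_polys_in[where 'v = 'v and 'f = 'f and V = V]

interpretation R: cring R by (rule cring_ring_on[OF S])
interpretation ideals: Group.comm_monoid "ideals_set R" by (rule R.ideals_set_is_comm_monoid)

section \<open>Powers of the ideal, their products with the maximal ideal, and degrees\<close>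

lemma is_subring_A: "is_subring A"
  unfolding A_def by (rule is_subring_hull)

lemma A_superset: "range (Poly_Mapping.single 0) \<subseteq> A" "X \<subseteq> A"
  unfolding A_def by (meson hull_subset le_sup_iff)+

lemma ideal_iff: "ideal K R \<longleftrightarrow> ideal_in (polys_in V) K"
  by (rule ideal_ring_on[OF S])

lemma ideal_M: "ideal M R"
  unfolding M_def graded_maximal_ideal_def poly_ring_eq
  by (rule R.genideal_ideal) (auto simp: var_in_polys_in)

lemma ideal_I: "ideal I R"
  unfolding I_def using X_in by (intro R.genideal_ideal) simp

lemma X_subset_I: "X \<subseteq> I"
  unfolding I_def using X_in by (intro R.genideal_self) simp

lemma ideal_pow: "ideal (pow k) R"
proof -
  have "pow k \<in> carrier (ideals_set R)"
    unfolding pow_def by (rule ideals.nat_pow_closed) (simp add: ideals_set_def ideal_I)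
  then show ?thesis by (simp add: ideals_set_def)
qed

lemma ideal_J: "ideal (J k) R"
  unfolding J_def by (rule R.ideal_prod_is_ideal[OF ideal_M ideal_pow])

lemma pow_0: "pow 0 = polys_in V"
  unfolding pow_def by (simp add: ideals_set_def)

lemma pow_add: "pow i \<cdot>\<^bsub>R\<^esub> pow j = pow (i + j)"
proof -
  have "pow i \<otimes>\<^bsub>ideals_set R\<^esub> pow j = pow (i + j)"
    unfolding pow_def by (rule ideals.nat_pow_mult) (simp add: ideals_set_def ideal_I)
  then show ?thesis by (simp add: ideals_set_def)
qed

lemma pow_Suc: "pow (Suc k) = pow k \<cdot>\<^bsub>R\<^esub> I"
  unfolding pow_def by (simp add: ideals_set_def)

lemma pow_1: "pow 1 = I"
  using pow_Suc[of 0] R.ideal_prod_commute[OF R.oneideal ideal_I] R.ideal_prod_one[OF ideal_I]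
  by (simp add: pow_0)

lemma J_mult_pow: "J i \<cdot>\<^bsub>R\<^esub> pow j = J (i + j)"
  unfolding J_def R.ideal_prod_assoc[OF ideal_M ideal_pow ideal_pow] pow_add ..

lemma mult_in_pow: "a \<in> pow i \<Longrightarrow> b \<in> pow j \<Longrightarrow> a * b \<in> pow (i + j)"
  unfolding pow_add[symmetric] by (rule ideal_prod_ring_onI)

lemma mult_in_J: "a \<in> J i \<Longrightarrow> b \<in> pow j \<Longrightarrow> a * b \<in> J (i + j)"
  unfolding J_mult_pow[symmetric] by (rule ideal_prod_ring_onI)

lemmas pow_ideal_in = ideal_pow[unfolded ideal_iff] and J_ideal_in = ideal_J[unfolded ideal_iff]

lemma J_subset_pow: "J k \<subseteq> pow k"
  unfolding J_def using R.ideal_prod_inter[OF ideal_M ideal_pow] by auto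

lemma pow_in: "a \<in> pow k \<Longrightarrow> a \<in> polys_in V"
  by (rule ideal_inD(1)[OF pow_ideal_in])

lemma X_min_degree: "X \<subseteq> min_degree_ideal V d"
proof
  fix x assume "x \<in> X"
  then have "x \<in> polys_in V" "x \<in> homog d" using X_in X_homog by auto
  then show "x \<in> min_degree_ideal V d" by (auto simp: min_degree_ideal_def homog_def)
qed

lemma pow_min_degree: "pow k \<subseteq> min_degree_ideal V (d * k)"
proof (induction k)
  case 0
  then show ?case by (simp add: pow_0 min_degree_ideal_0)
next
  case (Suc k)
  have I: "I \<subseteq> min_degree_ideal V d"
    unfolding I_def
    by (rule R.genideal_minimal) (simp_all add: ideal_iff ideal_in_min_degree_ideal X_min_degree)
  show ?case
  proof
    fix x assume "x \<in> pow (Suc k)"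
    then have "x \<in> pow k \<cdot>\<^bsub>R\<^esub> I" by (simp add: pow_Suc)
    then show "x \<in> min_degree_ideal V (d * Suc k)"
    proof (induction rule: ideal_prod_ring_on_induct)
      case (mult a b)
      then have "a * b \<in> min_degree_ideal V (d * k + d)" using Suc I by (intro min_degree_ideal_mult) auto
      then show ?case by (simp add: add.commute)
    qed (rule min_degree_ideal_add)
  qed
qed

lemma J_min_degree: "J k \<subseteq> min_degree_ideal V (Suc (d * k))"
proof
  have M: "M \<subseteq> min_degree_ideal V 1"
    unfolding M_def graded_maximal_ideal_def poly_ring_eq
  proof (rule R.genideal_minimal)
    show "ideal (min_degree_ideal V 1) R" by (simp add: ideal_iff ideal_in_min_degree_ideal)
    show "var ` V \<subseteq> min_degree_ideal V 1"
      by (auto simp: min_degree_ideal_def var_in_polys_in) (simp add: var_def)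
  qed
  fix x assume "x \<in> J k"
  then have "x \<in> M \<cdot>\<^bsub>R\<^esub> pow k" by (simp add: J_def)
  then show "x \<in> min_degree_ideal V (Suc (d * k))"
  proof (induction rule: ideal_prod_ring_on_induct)
    case (mult a b)
    then have "a * b \<in> min_degree_ideal V (1 + d * k)"
      using M pow_min_degree[of k] by (intro min_degree_ideal_mult) auto
    then show ?case by simp
  qed (rule min_degree_ideal_add)
qed

lemma homog_J_eq_0:
  assumes "a \<in> J k" "a \<in> homog (d * k)"
  shows "a = 0"
proof -
  have "Poly_Mapping.keys a = {}"
    using J_min_degree[of k] assms by (fastforce simp: min_degree_ideal_def homog_def)
  then show ?thesis by simp
qed

text \<open>The possible components of degree \<open>j\<close> of an element of \<open>A\<close>.
  Vanishing off the multiples of \<open>d\<close> and membership in the right power of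
  \<open>I\<close> are joined in one notion that is compatible with graded multiplication.\<close>

definition graded_part where "graded_part j = (if d dvd j then A \<inter> pow (j div d) else {0})"

lemma graded_part_add: "a \<in> graded_part j \<Longrightarrow> b \<in> graded_part j \<Longrightarrow> a + b \<in> graded_part j"
  using is_subringD(3)[OF is_subring_A] ideal_inD(3)[OF pow_ideal_in]
  by (auto simp: graded_part_def split: if_splits)

lemma graded_part_uminus: "a \<in> graded_part j \<Longrightarrow> - a \<in> graded_part j"
  using is_subringD(5)[OF is_subring_A] ideal_in_uminus[OF S pow_ideal_in]
  by (auto simp: graded_part_def split: if_splits)

lemma zero_graded_part: "0 \<in> graded_part j"
  using is_subringD(1)[OF is_subring_A] ideal_inD(2)[OF pow_ideal_in]
  by (auto simp: graded_part_def)

lemma graded_part_mult: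
  assumes "a \<in> graded_part i" "b \<in> graded_part j"
  shows "a * b \<in> graded_part (i + j)"
proof (cases "d dvd i \<and> d dvd j")
  case True
  then have "(i + j) div d = i div d + j div d" by (auto elim!: dvdE)
  then show ?thesis using assms True is_subringD(4)[OF is_subring_A] mult_in_pow
    by (auto simp: graded_part_def)
next
  case False
  then have "a * b = 0" using assms by (auto simp: graded_part_def)
  then show ?thesis by (simp add: zero_graded_part)
qed

text \<open>The polynomials with all components in \<open>graded_part\<close> form a subring
  containing the constants and \<open>X\<close>, hence contain \<open>A\<close>.\<close>

lemma hom_comp_A:
  assumes "a \<in> A"
  shows "hom_comp j a \<in> graded_part j"
proof -
  define D where "D = {a :: ('v, 'f) mpoly. \<forall>j. hom_comp j a \<in> graded_part j}"
  have "A \<subseteq> D"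
    unfolding A_def
  proof (rule hull_minimal)
    show "is_subring D"
      unfolding is_subring_def
    proof (intro conjI ballI)
      fix a b assume ab: "a \<in> D" "b \<in> D"
      then show "a + b \<in> D" by (simp add: D_def hom_comp_add graded_part_add)
      have "hom_comp j (a * b) \<in> graded_part j" for j
      proof -
        have "(\<Sum>i\<in>B. hom_comp i a * hom_comp (j - i) b) \<in> graded_part j" if "finite B" "B \<subseteq> {..j}" for B
          using that
        proof (induction B rule: finite_induct)
          case (insert i B)
          have "hom_comp i a * hom_comp (j - i) b \<in> graded_part (i + (j - i))"
            using ab by (intro graded_part_mult) (auto simp: D_def)
          then show ?case using insert by (simp add: graded_part_add)
        qed (simp add: zero_graded_part)
        then show ?thesis by (simp add: hom_comp_mult)
      qed
      then show "a * b \<in> D" by (simp add: D_def)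
    next
      fix a assume "a \<in> D"
      then show "- a \<in> D" by (simp add: D_def hom_comp_uminus graded_part_uminus)
    next
      show "0 \<in> D" by (simp add: D_def zero_graded_part)
      have "hom_comp j (1 :: ('v, 'f) mpoly) \<in> graded_part j" for j
        using hom_comp_homog[OF homog_const[of "1 :: 'f"], of j] zero_graded_part[of j]
          is_subringD(2)[OF is_subring_A] is_subringD(2)[OF S]
        by (cases "j = 0") (auto simp: graded_part_def pow_0)
      then show "1 \<in> D" by (simp add: D_def)
    qed
    show "range (Poly_Mapping.single 0) \<union> X \<subseteq> D"
    proof
      fix a assume "a \<in> range (Poly_Mapping.single 0) \<union> X"
      then consider c where "a = Poly_Mapping.single 0 c" | "a \<in> X" by auto
      then show "a \<in> D"
      proof cases
        case 1
        then have "hom_comp j a = (if j = 0 then a else 0)" for j by (simp add: hom_comp_homog[OF homog_const])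
        moreover have "a \<in> graded_part 0"
          using A_superset(1) 1 by (auto simp: graded_part_def pow_0 const_in_polys_in)
        ultimately show ?thesis by (simp add: D_def zero_graded_part)
      next
        case 2
        then have "a \<in> homog d" "a \<in> A" "a \<in> pow 1"
          using X_homog A_superset(2) X_subset_I unfolding pow_1 by auto
        then have "a \<in> graded_part d" using d_pos by (simp add: graded_part_def)
        then show ?thesis using \<open>a \<in> homog d\<close> by (simp add: D_def hom_comp_homog zero_graded_part)
      qed
    qed
  qed
  with assms show ?thesis by (auto simp: D_def)
qed

lemma hom_comp_A_mult: "a \<in> A \<Longrightarrow> hom_comp (d * k) a \<in> A" "a \<in> A \<Longrightarrow> hom_comp (d * k) a \<in> pow k"
  using hom_comp_A[of a "d * k"] d_pos by (auto simp: graded_part_def)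

lemma homog_A_in_pow: "w \<in> A \<Longrightarrow> w \<in> homog (d * k) \<Longrightarrow> w \<in> pow k"
  using hom_comp_A_mult(2)[of w k] by (simp add: hom_comp_homog)

lemma decompose_I:
  assumes "p \<in> I"
  shows "p \<in> I \<and> (\<exists>w\<in>A \<inter> homog d. p - w \<in> J 1)"
proof -
  \<comment> \<open>\<open>K\<close> will be an ideal containing \<open>X\<close>. Membership in
    \<open>I\<close> is part of it because closure under multiplication by \<open>r\<close> needs
    \<open>p\<close> in \<open>I\<close>, to place \<open>(r - c) * p\<close> in
    \<open>J 1\<close>.\<close>
  define K where "K = {p \<in> I. \<exists>w\<in>A \<inter> homog d. p - w \<in> J 1}"
  note II = ideal_I[unfolded ideal_iff]
  have "ideal_in (polys_in V) K"
    unfolding ideal_in_def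
  proof (intro conjI ballI)
    show "K \<subseteq> polys_in V" using ideal_inD(1)[OF II] by (auto simp: K_def)
    show "0 \<in> K"
      using ideal_inD(2)[OF II] ideal_inD(2)[OF J_ideal_in] is_subringD(1)[OF is_subring_A]
      by (auto simp: K_def intro!: bexI[of _ 0])
  next
    fix p q assume "p \<in> K" "q \<in> K"
    then obtain w z where *: "p \<in> I" "q \<in> I" "w \<in> A" "w \<in> homog d" "p - w \<in> J 1"
      "z \<in> A" "z \<in> homog d" "q - z \<in> J 1" by (auto simp: K_def)
    have "p + q - (w + z) = (p - w) + (q - z)" by simp
    also have "\<dots> \<in> J 1" by (rule ideal_inD(3)[OF J_ideal_in *(5,8)])
    finally have "p + q - (w + z) \<in> J 1" .
    moreover have "w + z \<in> A \<inter> homog d" using * is_subringD(3)[OF is_subring_A] homog_add by auto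
    ultimately show "p + q \<in> K" using ideal_inD(3)[OF II *(1,2)] by (auto simp: K_def)
  next
    fix r p :: "('v, 'f) mpoly" assume r: "r \<in> polys_in V" and "p \<in> K"
    then obtain w where p: "p \<in> I" and w: "w \<in> A" "w \<in> homog d" "p - w \<in> J 1" by (auto simp: K_def)
    \<comment> \<open>Only a scalar multiple of \<open>w\<close> stays homogeneous of degree
      \<open>d\<close>, so \<open>r\<close> is replaced by its constant term:
      \<open>r * p - c * w = (r - c) * p + c * (p - w)\<close>.\<close>
    define c where "c = (Poly_Mapping.single 0 (Poly_Mapping.lookup r 0) :: ('v, 'f) mpoly)"
    have "r - c \<in> M" unfolding M_def c_def by (rule diff_const_in_graded_maximal_ideal[OF r])
    then have "(r - c) * p \<in> J 1" unfolding J_def using p by (intro ideal_prod_ring_onI) (simp_all add: pow_1[simplified])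
    moreover have "c * (p - w) \<in> J 1"
      using w(3) by (intro ideal_inD(4)[OF J_ideal_in]) (simp add: c_def const_in_polys_in)
    ultimately have "(r - c) * p + c * (p - w) \<in> J 1" by (rule ideal_inD(3)[OF J_ideal_in])
    then have "r * p - c * w \<in> J 1" by (simp add: algebra_simps)
    moreover have "c * w \<in> A"
      using w(1) A_superset(1) by (intro is_subringD(4)[OF is_subring_A]) (auto simp: c_def)
    moreover have "c * w \<in> homog d" using homog_mult[OF homog_const w(2)] by (simp add: c_def)
    ultimately show "r * p \<in> K" using ideal_inD(4)[OF II r p] by (auto simp: K_def)
  qed
  moreover have "X \<subseteq> K"
  proof
    fix x assume "x \<in> X"
    then show "x \<in> K"
      using X_subset_I A_superset(2) X_homog ideal_inD(2)[OF J_ideal_in, of 1]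
      by (auto simp: K_def intro!: bexI[of _ x])
  qed
  ultimately have "I \<subseteq> K" unfolding I_def by (intro R.genideal_minimal) (simp_all add: ideal_iff)
  with assms show ?thesis by (auto simp: K_def)
qed

text \<open>The degree \<open>d k\<close> part of \<open>F[X]\<close> is a complement of \<open>M I\<^sup>k\<close> in \<open>I\<^sup>k\<close>; it meets \<open>M I\<^sup>k\<close> trivially as
  the elements of \<open>M I\<^sup>k\<close> have no terms of degree \<open>\<le> d k\<close>.\<close>

lemma decompose_pow:
  "p \<in> pow k \<Longrightarrow> \<exists>w\<in>A \<inter> homog (d * k). p - w \<in> J k"
proof (induction k arbitrary: p)
  case 0
  then have p: "p \<in> polys_in V" by (simp add: pow_0)
  have "J 0 = M" unfolding J_def pow_0 using R.ideal_prod_one[OF ideal_M] by simp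
  then show ?case
    using diff_const_in_graded_maximal_ideal[OF p] A_superset(1) homog_const
    by (auto simp: M_def intro!: bexI[of _ "Poly_Mapping.single 0 (Poly_Mapping.lookup p 0)"])
next
  case (Suc k)
  from Suc.prems have "p \<in> pow k \<cdot>\<^bsub>R\<^esub> I" by (simp add: pow_Suc)
  then show ?case
  proof (induction rule: ideal_prod_ring_on_induct)
    case (mult a b)
    obtain w where w: "w \<in> A" "w \<in> homog (d * k)" "a - w \<in> J k" using Suc.IH[OF mult(1)] by auto
    obtain z where z: "z \<in> A" "z \<in> homog d" "b - z \<in> J 1" using decompose_I[OF mult(2)] by auto
    have "b \<in> pow 1" using mult(2) unfolding pow_1 .
    \<comment> \<open>The error \<open>a * b - w * z\<close> equals
      \<open>(a - w) * b + (b - z) * w\<close>, and in each summand one factor is in some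
      \<open>J\<close> and the other in a power of \<open>I\<close>.\<close>
    from mult_in_J[OF w(3) this] have "(a - w) * b \<in> J (Suc k)" by simp
    moreover have "(b - z) * w \<in> J (Suc k)"
      using mult_in_J[OF z(3) homog_A_in_pow[OF w(1,2)]] by simp
    ultimately have "(a - w) * b + (b - z) * w \<in> J (Suc k)" by (rule ideal_inD(3)[OF J_ideal_in])
    then have "a * b - w * z \<in> J (Suc k)" by (simp add: algebra_simps)
    moreover have "w * z \<in> homog (d * Suc k)" using homog_mult[OF w(2) z(2)] by (simp add: add.commute)
    ultimately show ?case using is_subringD(4)[OF is_subring_A w(1) z(1)] by auto
  next
    case (add x y)
    then obtain w z where *: "w \<in> A" "w \<in> homog (d * Suc k)" "x - w \<in> J (Suc k)"
      "z \<in> A" "z \<in> homog (d * Suc k)" "y - z \<in> J (Suc k)" by auto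
    have "x + y - (w + z) = (x - w) + (y - z)" by simp
    also have "\<dots> \<in> J (Suc k)" by (rule ideal_inD(3)[OF J_ideal_in *(3,6)])
    finally have "x + y - (w + z) \<in> J (Suc k)" .
    moreover have "w + z \<in> A \<inter> homog (d * Suc k)" using * is_subringD(3)[OF is_subring_A] homog_add by auto
    ultimately show ?case by auto
  qed
qed

section \<open>The isomorphism from F[X] to the special fiber ring\<close>

definition \<Phi> :: "('v, 'f) mpoly \<Rightarrow> nat \<Rightarrow> ('v, 'f) mpoly set" where
  "\<Phi> a k = J k +>\<^bsub>R\<^esub> hom_comp (d * k) a"

abbreviation fiber where "fiber \<equiv> special_fiber_ring R M I"

lemma fiber_simps:
  "carrier fiber = {x. (\<forall>k. x k \<in> {J k +>\<^bsub>R\<^esub> a | a. a \<in> pow k}) \<and> finite {k. x k \<noteq> J k}}"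
  "mult fiber x y k = (\<Oplus>\<^bsub>R Quot J k\<^esub>i\<in>{..k}. ([mod J k:] x i \<Otimes>\<^bsub>R\<^esub> y (k - i)))"
  "one fiber k = (if k = 0 then J 0 +>\<^bsub>R\<^esub> 1 else J k)"
  "zero fiber = J"
  "add fiber x y k = x k <+>\<^bsub>R\<^esub> y k"
proof -
  have *: "(\<lambda>k. M \<cdot>\<^bsub>R\<^esub> ideal_power R I k) = J" by (simp add: fun_eq_iff J_def pow_def)
  show "carrier fiber = {x. (\<forall>k. x k \<in> {J k +>\<^bsub>R\<^esub> a | a. a \<in> pow k}) \<and> finite {k. x k \<noteq> J k}}"
    "mult fiber x y k = (\<Oplus>\<^bsub>R Quot J k\<^esub>i\<in>{..k}. ([mod J k:] x i \<Otimes>\<^bsub>R\<^esub> y (k - i)))"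
    "one fiber k = (if k = 0 then J 0 +>\<^bsub>R\<^esub> 1 else J k)"
    "zero fiber = J" "add fiber x y k = x k <+>\<^bsub>R\<^esub> y k"
    unfolding special_fiber_ring_def Let_def * by (simp_all add: pow_def)
qed

text \<open>Three moduli occur, so this is not a product inside one quotient ring.
  \<open>rcoset_mult\<close> is a union over pairs of representatives; all pairs give the same coset
  because products of \<open>J\<close> with powers of \<open>I\<close> land in
  \<open>J (i + j)\<close>, and the index sets are nonempty.\<close>

lemma rcoset_mult_pow:
  assumes "u \<in> pow i" "v \<in> pow j"
  shows "[mod J (i + j):] (J i +>\<^bsub>R\<^esub> u) \<Otimes>\<^bsub>R\<^esub> (J j +>\<^bsub>R\<^esub> v) = J (i + j) +>\<^bsub>R\<^esub> (u * v)"
proof -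
  have eq: "J (i + j) +>\<^bsub>R\<^esub> (a * b) = J (i + j) +>\<^bsub>R\<^esub> (u * v)"
    if ab: "a \<in> J i +>\<^bsub>R\<^esub> u" "b \<in> J j +>\<^bsub>R\<^esub> v" for a b
  proof -
    obtain h g where *: "h \<in> J i" "g \<in> J j" "a = h + u" "b = g + v" using ab by (auto simp: coset_ring_on)
    have b: "b \<in> pow j"
      unfolding *(4) using J_subset_pow *(2) assms(2) by (intro ideal_inD(3)[OF pow_ideal_in]) auto
    have "h * b + g * u \<in> J (i + j)"
      using mult_in_J[OF *(1) b] mult_in_J[OF *(2) assms(1)]
      by (intro ideal_inD(3)[OF J_ideal_in]) (simp_all add: add.commute)
    moreover have "a * b - u * v = h * b + g * u" by (simp add: *(3,4) algebra_simps)
    ultimately show ?thesis by (simp add: coset_ring_on_eq_iff[OF S J_ideal_in])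
  qed
  have "0 + u \<in> J i +>\<^bsub>R\<^esub> u" "0 + v \<in> J j +>\<^bsub>R\<^esub> v"
    unfolding coset_ring_on by (intro imageI ideal_inD(2)[OF J_ideal_in])+
  then have "J i +>\<^bsub>R\<^esub> u \<noteq> {}" "J j +>\<^bsub>R\<^esub> v \<noteq> {}" by blast+
  then show ?thesis unfolding rcoset_mult_def ring_on_simps by (simp only: eq UN_constant cong: SUP_cong) simp
qed

lemma hom_comp_A_in: "a \<in> A \<Longrightarrow> hom_comp (d * k) a \<in> polys_in V"
  by (rule pow_in[OF hom_comp_A_mult(2)])

lemma \<Phi>_mult:
  assumes "a \<in> A" "b \<in> A"
  shows "\<Phi> (a * b) = \<Phi> a \<otimes>\<^bsub>fiber\<^esub> \<Phi> b"
proof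
  fix k
  interpret J: ideal "J k" R by (rule ideal_J)
  interpret Q: ring_hom_cring R "R Quot J k" "(+>\<^bsub>R\<^esub>) (J k)"
    by (rule J.rcos_ring_hom_cring) (rule R.cring_axioms)
  define f where "f i = hom_comp (d * i) a * hom_comp (d * (k - i)) b" for i
  have f: "f i \<in> polys_in V" for i
    unfolding f_def using assms by (intro is_subringD(4)[OF S] hom_comp_A_in)
  have "(\<Phi> a \<otimes>\<^bsub>fiber\<^esub> \<Phi> b) k = (\<Oplus>\<^bsub>R Quot J k\<^esub>i\<in>{..k}. ([mod J k:] \<Phi> a i \<Otimes>\<^bsub>R\<^esub> \<Phi> b (k - i)))"
    by (rule fiber_simps)
  also have "\<dots> = (\<Oplus>\<^bsub>R Quot J k\<^esub>i\<in>{..k}. (J k +>\<^bsub>R\<^esub> f i))"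
  proof (rule Q.S.finsum_cong')
    show "(\<lambda>i. J k +>\<^bsub>R\<^esub> f i) \<in> {..k} \<rightarrow> carrier (R Quot J k)"
      using f Q.hom_closed by auto
    fix i assume "i \<in> {..k}"
    then show "[mod J k:] \<Phi> a i \<Otimes>\<^bsub>R\<^esub> \<Phi> b (k - i) = J k +>\<^bsub>R\<^esub> f i"
      using rcoset_mult_pow[OF hom_comp_A_mult(2)[OF assms(1), of i] hom_comp_A_mult(2)[OF assms(2), of "k - i"]]
      by (simp add: \<Phi>_def f_def)
  qed simp
  also have "\<dots> = J k +>\<^bsub>R\<^esub> finsum R f {..k}"
    using Q.hom_finsum[of f "{..k}"] f by (simp add: Pi_def comp_def)
  also have "finsum R f {..k} = (\<Sum>i\<le>k. f i)" using f by (intro finsum_ring_on[OF S]) auto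
  also have "\<dots> = hom_comp (d * k) (a * b)"
  proof -
    have "hom_comp (d * k) (a * b) = (\<Sum>j\<le>d * k. hom_comp j a * hom_comp (d * k - j) b)"
      by (rule hom_comp_mult)
    \<comment> \<open>Degrees that are not multiples of \<open>d\<close> drop out, as the components
      of \<open>a\<close> vanish there.\<close>
    also have "\<dots> = (\<Sum>j\<in>(*) d ` {..k}. hom_comp j a * hom_comp (d * k - j) b)"
    proof (intro sum.mono_neutral_right ballI)
      fix j assume j: "j \<in> {..d * k} - (*) d ` {..k}"
      then have "\<not> d dvd j" using d_pos by (auto elim!: dvdE)
      then have "hom_comp j a = 0" using hom_comp_A[OF assms(1), of j] by (simp add: graded_part_def)
      then show "hom_comp j a * hom_comp (d * k - j) b = 0" by simp
    qed auto
    also have "\<dots> = (\<Sum>i\<le>k. f i)"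
      using d_pos by (subst sum.reindex) (auto simp: inj_on_def f_def right_diff_distrib')
    finally show ?thesis by simp
  qed
  finally show "\<Phi> (a * b) k = (\<Phi> a \<otimes>\<^bsub>fiber\<^esub> \<Phi> b) k" unfolding \<Phi>_def[of "a * b" k] by (rule sym)
qed

lemma \<Phi>_add:
  assumes "a \<in> A" "b \<in> A"
  shows "\<Phi> (a + b) = \<Phi> a \<oplus>\<^bsub>fiber\<^esub> \<Phi> b"
proof
  fix k
  interpret J: ideal "J k" R by (rule ideal_J)
  show "\<Phi> (a + b) k = (\<Phi> a \<oplus>\<^bsub>fiber\<^esub> \<Phi> b) k"
    unfolding fiber_simps \<Phi>_def
    using J.a_rcos_sum[of "hom_comp (d * k) a" "hom_comp (d * k) b"] hom_comp_A_in assms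
    by (simp add: hom_comp_add)
qed

lemma \<Phi>_one: "\<Phi> 1 = \<one>\<^bsub>fiber\<^esub>"
proof
  fix k
  have "hom_comp (d * k) (1 :: ('v, 'f) mpoly) = (if k = 0 then 1 else 0)"
    using hom_comp_homog[OF homog_const[of "1 :: 'f"], of "d * k"] d_pos by (cases "k = 0") simp_all
  then show "\<Phi> 1 k = \<one>\<^bsub>fiber\<^esub> k" by (simp add: \<Phi>_def fiber_simps coset_ring_on_zero)
qed

lemma \<Phi>_zero: "\<Phi> 0 = \<zero>\<^bsub>fiber\<^esub>"
  by (simp add: fun_eq_iff \<Phi>_def fiber_simps coset_ring_on_zero)

lemma \<Phi>_closed:
  assumes "a \<in> A"
  shows "\<Phi> a \<in> carrier fiber"
  unfolding fiber_simps
proof (intro CollectI conjI allI)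
  fix k
  show "\<exists>u. \<Phi> a k = J k +>\<^bsub>R\<^esub> u \<and> u \<in> pow k"
    using hom_comp_A_mult(2)[OF assms] by (auto simp: \<Phi>_def)
next
  have "{k. \<Phi> a k \<noteq> J k} \<subseteq> (\<lambda>k. d * k) -` {j. hom_comp j a \<noteq> 0}"
    by (auto simp: \<Phi>_def coset_ring_on_zero)
  moreover have "finite ((\<lambda>k. d * k) -` {j. hom_comp j a \<noteq> 0})"
    using d_pos by (intro finite_vimageI finite_hom_comp_support) (auto simp: inj_on_def)
  ultimately show "finite {k. \<Phi> a k \<noteq> J k}" by (rule finite_subset)
qed

text \<open>In degree \<open>d * k\<close> the difference of the components is homogeneous and lies
  in \<open>J k\<close>, which has only terms of larger degree. In degrees not divisible by
  \<open>d\<close> both components are zero.\<close>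

lemma \<Phi>_inj: "inj_on \<Phi> A"
proof (rule inj_onI, rule hom_comp_eqI)
  fix a b j assume ab: "a \<in> A" "b \<in> A" "\<Phi> a = \<Phi> b"
  show "hom_comp j a = hom_comp j b"
  proof (cases "d dvd j")
    case True
    then obtain k where k: "j = d * k" by (auto elim: dvdE)
    have "\<Phi> a k = \<Phi> b k" using ab(3) by simp
    then have "hom_comp (d * k) a - hom_comp (d * k) b \<in> J k"
      by (simp add: \<Phi>_def coset_ring_on_eq_iff[OF S J_ideal_in])
    moreover have "hom_comp (d * k) a - hom_comp (d * k) b \<in> homog (d * k)"
      using homog_add[OF hom_comp_in_homog homog_uminus[OF hom_comp_in_homog], of "d * k" a b] by simp
    ultimately have "hom_comp (d * k) a - hom_comp (d * k) b = 0" by (rule homog_J_eq_0)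
    then show ?thesis by (simp add: k)
  next
    case False
    then show ?thesis using hom_comp_A[OF ab(1), of j] hom_comp_A[OF ab(2), of j] by (simp add: graded_part_def)
  qed
qed

lemma \<Phi>_surj: "carrier fiber \<subseteq> \<Phi> ` A"
proof
  fix x assume "x \<in> carrier fiber"
  then have x: "\<And>k. \<exists>a. x k = J k +>\<^bsub>R\<^esub> a \<and> a \<in> pow k" and fin: "finite {k. x k \<noteq> J k}"
    by (auto simp: fiber_simps)
  have "\<exists>w. w \<in> A \<and> w \<in> homog (d * k) \<and> x k = J k +>\<^bsub>R\<^esub> w" for k
  proof -
    obtain a where a: "x k = J k +>\<^bsub>R\<^esub> a" "a \<in> pow k" using x by blast
    obtain w where "w \<in> A \<inter> homog (d * k)" "a - w \<in> J k" using decompose_pow[OF a(2)] by blast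
    then show ?thesis using a(1) by (auto simp: coset_ring_on_eq_iff[OF S J_ideal_in])
  qed
  then obtain w where w: "\<And>k. w k \<in> A" "\<And>k. w k \<in> homog (d * k)" "\<And>k. x k = J k +>\<^bsub>R\<^esub> w k" by metis
  \<comment> \<open>The homogeneous representatives of the finitely many nonzero entries are added
    up; having different degrees, they are recovered as the components of the sum.\<close>
  define a where "a = (\<Sum>k | x k \<noteq> J k. w k)"
  have "a \<in> A" unfolding a_def by (rule is_subring_sum[OF is_subring_A w(1)])
  moreover have "\<Phi> a = x"
  proof
    fix k
    have "hom_comp (d * k) a = (\<Sum>i | x i \<noteq> J i. if i = k then w k else 0)"
      unfolding a_def hom_comp_sum using d_pos by (intro sum.cong refl) (auto simp: hom_comp_homog[OF w(2)])
    also have "\<dots> = (if x k \<noteq> J k then w k else 0)" using fin by (simp add: sum.delta)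
    finally show "\<Phi> a k = x k" using w(3)[of k] by (simp add: \<Phi>_def coset_ring_on_zero)
  qed
  ultimately show "x \<in> \<Phi> ` A" by blast
qed

lemma \<Phi>_iso: "\<Phi> \<in> ring_iso (ring_on A) fiber"
proof (rule ring_iso_memI)
  show "bij_betw \<Phi> (carrier (ring_on A)) (carrier fiber)"
    using \<Phi>_inj \<Phi>_surj \<Phi>_closed by (auto simp: bij_betw_def)
qed (simp_all add: \<Phi>_closed \<Phi>_mult \<Phi>_add \<Phi>_one)

text \<open>The ring axioms are transported along \<open>\<Phi>\<close> instead of being checked on
  sequences of cosets. The transport installs \<open>\<Phi> 0\<close> as zero, which is the original
  zero by \<open>\<Phi>_zero\<close>.\<close>

lemma cring_fiber: "cring fiber"
proof -
  interpret A: cring "ring_on A" by (rule cring_ring_on[OF is_subring_A])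
  have "cring (fiber\<lparr>zero := \<Phi> \<zero>\<^bsub>ring_on A\<^esub>\<rparr>)" by (rule A.ring_iso_imp_img_cring[OF \<Phi>_iso])
  then show ?thesis by (simp add: \<Phi>_zero)
qed

theorem analytic_spread_eq: "analytic_spread V (genideal (poly_ring V) X) = krull_dim (ring_on A)"
  using krull_dim_iso[OF cring_ring_on[OF is_subring_A] cring_fiber \<Phi>_iso]
  unfolding analytic_spread_def poly_ring_eq M_def[symmetric] I_def[symmetric] .

end

section \<open>Binomial edge ideals\<close>

definition edge_binomials ::
    "'a::linorder pair_pre_digraph \<Rightarrow> 'b::linorder pair_pre_digraph \<Rightarrow> ('a \<times> 'b, 'f::field) mpoly set"
  where
  "edge_binomials G H = {var (i, k) * var (j, l) - var (i, l) * var (j, k) | i j k l.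
     (i, j) \<in> parcs G \<and> i < j \<and> (k, l) \<in> parcs H \<and> k < l}"

lemma finite_edge_binomials:
  assumes "pair_graph G" "pair_graph H"
  shows "finite (edge_binomials G H)"
proof -
  interpret G: pair_graph G by (rule assms)
  interpret H: pair_graph H by (rule assms)
  have "edge_binomials G H \<subseteq>
      (\<lambda>((i, j), (k, l)). var (i, k) * var (j, l) - var (i, l) * var (j, k)) ` (parcs G \<times> parcs H)"
    unfolding edge_binomials_def by force
  then show ?thesis
    by (rule finite_subset) simp
qed

lemma var_homog: "var v \<in> homog 1"
  by (simp add: var_def homog_def)

lemma equigenerated_edge_binomials:
  assumes "pair_graph G" "pair_graph H"
  shows "equigenerated_ideal (pverts G \<times> pverts H) (edge_binomials G H :: ('a::linorder \<times> 'b::linorder, 'f::field) mpoly set) 2"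
proof
  interpret G: pair_graph G by (rule assms)
  interpret H: pair_graph H by (rule assms)
  note S = is_subringD[OF is_subring_polys_in]
  show "edge_binomials G H \<subseteq> polys_in (pverts G \<times> pverts H)"
    unfolding edge_binomials_def
    by (auto intro!: S var_in_polys_in dest: G.wellformed H.wellformed)
  show "edge_binomials G H \<subseteq> (homog 2 :: ('a \<times> 'b, 'f) mpoly set)"
  proof
    fix p :: "('a \<times> 'b, 'f) mpoly" assume "p \<in> edge_binomials G H"
    then obtain i j k l where p: "p = var (i, k) * var (j, l) + - (var (i, l) * var (j, k))"
      unfolding edge_binomials_def by auto
    have "var u * var v \<in> (homog 2 :: ('a \<times> 'b, 'f) mpoly set)" for u v
      using homog_mult[OF var_homog var_homog, of u v] by (simp add: numeral_2_eq_2)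
    then show "p \<in> homog 2" unfolding p by (intro homog_add homog_uminus)
  qed
qed simp

lemma is_subring_constants: "is_subring (range (Poly_Mapping.single 0 :: 'f::field \<Rightarrow> ('v, 'f) mpoly))"
  unfolding is_subring_def
  by (auto simp flip: single_add single_uminus simp: mult_single
      intro: range_eqI[of _ _ 0] range_eqI[of _ _ 1])

lemma constants_inverse:
  fixes x :: "('v, 'f::field) mpoly"
  assumes "x \<in> range (Poly_Mapping.single 0)" "x \<noteq> 0"
  shows "\<exists>y\<in>range (Poly_Mapping.single 0). x * y = 1"
proof -
  obtain c where x: "x = Poly_Mapping.single 0 c" using assms(1) by auto
  with assms(2) have "c \<noteq> 0" by auto
  with x have "x * Poly_Mapping.single 0 (inverse c) = 1" by (simp add: mult_single)
  then show ?thesis by blast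
qed

theorem corollary1p5:
  fixes G G' :: "'a::linorder pair_pre_digraph"
    and H H' :: "'b::linorder pair_pre_digraph"
  assumes "pair_graph G" "pair_graph G'" "pair_graph H" "pair_graph H'"
    and "no_isolated_vertices G" "no_isolated_vertices G'"
    and "no_isolated_vertices H" "no_isolated_vertices H'"
    and "subgraph (with_proj G) (with_proj G')"
    and "subgraph (with_proj H) (with_proj H')"
    and "CHAR('f::field) = 0 \<or> CHAR('f) > 2 ^ (card (pverts G') * card (pverts H'))"
  shows "analytic_spread (pverts G \<times> pverts H)
           (binomial_edge_ideal G H :: ('a \<times> 'b, 'f) mpoly set)
       \<le> analytic_spread (pverts G' \<times> pverts H')
           (binomial_edge_ideal G' H' :: ('a \<times> 'b, 'f) mpoly set)"
proof -
  define X :: "('a \<times> 'b, 'f) mpoly set" where "X = edge_binomials G H"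
  define X' :: "('a \<times> 'b, 'f) mpoly set" where "X' = edge_binomials G' H'"
  define F :: "('a \<times> 'b, 'f) mpoly set" where "F = range (Poly_Mapping.single 0)"
  interpret G: equigenerated_ideal "pverts G \<times> pverts H" X 2
    unfolding X_def by (rule equigenerated_edge_binomials[OF assms(1,3)])
  interpret G': equigenerated_ideal "pverts G' \<times> pverts H'" X' 2
    unfolding X'_def by (rule equigenerated_edge_binomials[OF assms(2,4)])
  have "parcs G \<subseteq> parcs G'" "parcs H \<subseteq> parcs H'" using assms(9,10) by (auto elim!: subgraphE)
  \<comment> \<open>The variables belong to the type and not to the vertex sets, so this is a
    literal inclusion although the two polynomial rings differ. The algebras generated by
    \<open>X\<close> and \<open>X'\<close> over the constants do not refer to the vertex sets
    either.\<close>
  then have "X \<subseteq> X'" unfolding X_def X'_def edge_binomials_def by blast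
  have "krull_dim (ring_on (is_subring hull (F \<union> X))) \<le> krull_dim (ring_on (is_subring hull (F \<union> X')))"
  proof (rule krull_dim_subalgebra_mono)
    show "is_subring F" unfolding F_def by (rule is_subring_constants)
    show "\<exists>y\<in>F. x * y = 1" if "x \<in> F" "x \<noteq> 0" for x
      using that unfolding F_def by (rule constants_inverse)
    show "is_subring (is_subring hull (F \<union> X))" by (rule is_subring_hull)
    show "F \<subseteq> is_subring hull (F \<union> X)" by (rule order.trans[OF Un_upper1 hull_subset])
    show "is_subring hull (F \<union> X) \<subseteq> is_subring hull (F \<union> X')"
      using \<open>X \<subseteq> X'\<close> by (intro hull_mono) auto
    show "finite X'" unfolding X'_def by (rule finite_edge_binomials[OF assms(2,4)])
  qed
  then show ?thesis
    unfolding binomial_edge_ideal_def edge_binomials_def[symmetric] X_def[symmetric] X'_def[symmetric]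
      G.analytic_spread_eq G'.analytic_spread_eq G.A_def G'.A_def F_def .
qed

end
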